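(* Let $p>1/2$ and $C\geq\sqrt{\frac{2p-1}{2}}$ be fixed. If $\{e_n\}_{n=1}^N\subset L^2(\mathbb{R})$ is an orthonormal set such that for all $1\leq n\leq N$ and for almost every $x,\xi\in\mathbb{R}$, $$|e_n(x)|\leq\frac{C}{(1+|x|)^p}\quad\text{and}\quad|\widehat{e}_n(\xi)|\leq\frac{C}{(1+|\xi|)^p},$$ then $$N\leq\begin{cases} 9^{\left(\frac{200\sqrt{2}\,C}{\sqrt{2p-1}}\right)^{\frac{4}{2p-1}}}&\text{if } 1/2<p,\\[4pt] 16\left(\frac{400C^2}{2p-1}\right)^{\frac{1}{p-1}}&\text{if } 1<p\leq3/2,\\[4pt] 4\left(\frac{500C^2}{2p-1}\right)^{\frac{2}{2p-3}}&\text{if } 3/2<p. \end{cases}$$ (Each bound holds in the whole range of $p$ indicated next to it.)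
   Context: The Fourier transform is $\widehat{f}(\xi)=\int f(t)e^{-2i\pi t\xi}\,dt$ for $f\in L^1(\mathbb{R})$, extended to $L^2(\mathbb{R})$ as usual. *)

theory Defs
  imports "HOL-Analysis.Analysis"
begin

(* Elements of L^2(R) are represented by functions, not by classes modulo a.e. equality;
   everything below depends on the argument functions only up to a.e. equality. *)
definition L2 :: "(real \<Rightarrow> complex) set" where
  "L2 = {f \<in> borel_measurable lebesgue. integrable lebesgue (\<lambda>x. (cmod (f x))\<^sup>2)}"

definition L2_inner :: "(real \<Rightarrow> complex) \<Rightarrow> (real \<Rightarrow> complex) \<Rightarrow> complex" where
  "L2_inner f g = (LINT x|lebesgue. f x * cnj (g x))"

definition L2_norm :: "(real \<Rightarrow> complex) \<Rightarrow> real" where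
  "L2_norm f = sqrt (LINT x|lebesgue. (cmod (f x))\<^sup>2)"

definition L2_orthonormal :: "'i set \<Rightarrow> ('i \<Rightarrow> real \<Rightarrow> complex) \<Rightarrow> bool" where
  "L2_orthonormal I e \<longleftrightarrow> (\<forall>i\<in>I. e i \<in> L2) \<and>
     (\<forall>i\<in>I. \<forall>j\<in>I. L2_inner (e i) (e j) = (if i = j then 1 else 0))"

definition fourier_L1 :: "(real \<Rightarrow> complex) \<Rightarrow> real \<Rightarrow> complex" where
  "fourier_L1 f \<xi> =
     (LINT t|lebesgue. f t * exp (- 2 * \<i> * of_real pi * of_real t * of_real \<xi>))"

(* Extension by density of L^1 \<inter> L^2 in L^2. By Plancherel, a transform g exists for every
   f in L^2, is unique up to a.e. equality and does not depend on the approximating sequence,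
   and the condition that the transforms of the approximants lie in L^2 is automatic; it is
   stated because L2_norm is only meaningful on L2. *)
definition has_fourier_L2 :: "(real \<Rightarrow> complex) \<Rightarrow> (real \<Rightarrow> complex) \<Rightarrow> bool" where
  "has_fourier_L2 f g \<longleftrightarrow> f \<in> L2 \<and> g \<in> L2 \<and>
     (\<exists>\<phi> :: nat \<Rightarrow> real \<Rightarrow> complex.
        (\<forall>k. integrable lebesgue (\<phi> k) \<and> \<phi> k \<in> L2 \<and> fourier_L1 (\<phi> k) \<in> L2) \<and>
        (\<lambda>k. L2_norm (\<lambda>x. \<phi> k x - f x)) \<longlonglongrightarrow> 0 \<and>
        (\<lambda>k. L2_norm (\<lambda>\<xi>. fourier_L1 (\<phi> k) \<xi> - g \<xi>)) \<longlonglongrightarrow> 0)"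

(* A representative; determined up to a.e. equality for f in L^2. *)
definition fourier_L2 :: "(real \<Rightarrow> complex) \<Rightarrow> real \<Rightarrow> complex" where
  "fourier_L2 f = (SOME g. has_fourier_L2 f g)"

end

theory Submission
  imports Defs "HOL-Probability.Probability"
begin

text \<open>
  Let \<open>F\<close> be the Fourier transform, \<open>P\<close> the restriction to \<open>[-T,T]\<close> and \<open>Q\<close> the frequency restriction to \<open>[-W,W]\<close>. Bessel's
  inequality for the truncated exponentials bounds the sum of \<open>|F (P e\<^sub>n) \<xi>|\<^sup>2\<close> over \<open>n\<close> by \<open>2T\<close> for each
  \<open>\<xi>\<close>, so the sum of \<open>\<parallel>Q P e\<^sub>n\<parallel>\<^sup>2\<close> is at most \<open>4TW\<close>. If all \<open>e\<^sub>n\<close> and their transforms have at most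
  mass \<open>\<eta>\<close> outside the two intervals, Plancherel gives \<open>\<parallel>Q P e\<^sub>n\<parallel>\<^sup>2 \<ge> 1 - 5\<eta>\<close>, whence
  \<open>N (1 - 5\<eta>) \<le> 4TW\<close>. Under the decay hypothesis \<open>T = W = y - 1\<close> admits \<open>\<eta> = K y powr (1 - 2p)\<close> with
  \<open>K = 2C\<^sup>2/(2p - 1) \<ge> 1\<close>, and each bound follows by choosing \<open>y\<close> as the appropriate power of a multiple
  of \<open>K\<close>. Plancherel itself is obtained by Gaussian summation: \<open>|F f|\<^sup>2\<close> is the transform of the
  autocorrelation of \<open>f\<close>, which is continuous at \<open>0\<close> for bounded integrable \<open>f\<close>.\<close>

section \<open>Square-integrable functions\<close>

lemma L2_measurable: "f \<in> L2 \<Longrightarrow> f \<in> borel_measurable lebesgue"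
  and L2_integrable: "f \<in> L2 \<Longrightarrow> integrable lebesgue (\<lambda>x. (cmod (f x))\<^sup>2)"
  by (auto simp: L2_def)

lemma L2_norm_nonneg: "0 \<le> L2_norm f"
  by (simp add: L2_norm_def)

lemma L2_norm_square: "(L2_norm f)\<^sup>2 = (LINT x|lebesgue. (cmod (f x))\<^sup>2)"
  by (simp add: L2_norm_def)

lemma L2_bound:
  assumes "f \<in> borel_measurable lebesgue" "integrable lebesgue w"
    and "AE x in lebesgue. (cmod (f x))\<^sup>2 \<le> w x"
  shows "f \<in> L2"
proof -
  have "integrable lebesgue (\<lambda>x. (cmod (f x))\<^sup>2)"
  proof (rule Bochner_Integration.integrable_bound[OF assms(2)])
    show "(\<lambda>x. (cmod (f x))\<^sup>2) \<in> borel_measurable lebesgue"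
      using assms(1) by measurable
    show "AE x in lebesgue. norm ((cmod (f x))\<^sup>2) \<le> norm (w x)"
      using assms(3) by eventually_elim auto
  qed
  then show ?thesis using assms(1) by (simp add: L2_def)
qed

text \<open>The defect is the square \<open>(t * cmod a - cmod b)\<^sup>2 / t\<close>. The free
  weight serves two purposes: \<open>t = 1\<close> gives the crude factor 2, and optimizing
  \<open>t\<close> gives Minkowski's inequality.\<close>

lemma cmod_add_square_le:
  fixes a b :: complex and t :: real
  assumes "t > 0"
  shows "(cmod (a + b))\<^sup>2 \<le> (1 + t) * (cmod a)\<^sup>2 + (1 + 1 / t) * (cmod b)\<^sup>2"
proof -
  have "(cmod (a + b))\<^sup>2 \<le> (cmod a + cmod b)\<^sup>2"
    by (intro power_mono norm_triangle_ineq) auto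
  also have "\<dots> = (1 + t) * (cmod a)\<^sup>2 + (1 + 1 / t) * (cmod b)\<^sup>2 - (t * cmod a - cmod b)\<^sup>2 / t"
    using assms by (simp add: field_simps power2_eq_square)
  also have "\<dots> \<le> (1 + t) * (cmod a)\<^sup>2 + (1 + 1 / t) * (cmod b)\<^sup>2"
    using assms by simp
  finally show ?thesis .
qed

lemma L2_add:
  assumes "f \<in> L2" "g \<in> L2"
  shows "(\<lambda>x. f x + g x) \<in> L2"
proof (rule L2_bound)
  show "(\<lambda>x. f x + g x) \<in> borel_measurable lebesgue"
    using assms[THEN L2_measurable] by measurable
  show "integrable lebesgue (\<lambda>x. 2 * (cmod (f x))\<^sup>2 + 2 * (cmod (g x))\<^sup>2)"
    using assms[THEN L2_integrable] by auto
  show "AE x in lebesgue. (cmod (f x + g x))\<^sup>2 \<le> 2 * (cmod (f x))\<^sup>2 + 2 * (cmod (g x))\<^sup>2"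
    using cmod_add_square_le[of 1] by auto
qed

lemma L2_cmult: "f \<in> L2 \<Longrightarrow> (\<lambda>x. c * f x) \<in> L2"
  unfolding L2_def by (auto simp: norm_mult power_mult_distrib)

lemma L2_diff: "f \<in> L2 \<Longrightarrow> g \<in> L2 \<Longrightarrow> (\<lambda>x. f x - g x) \<in> L2"
  using L2_add[OF _ L2_cmult[of g "-1"], of f] by simp

lemma L2_sum: "(\<And>i. i \<in> I \<Longrightarrow> f i \<in> L2) \<Longrightarrow> (\<lambda>x. \<Sum>i\<in>I. f i x) \<in> L2"
proof (induction I rule: infinite_finite_induct)
  case (insert i I)
  then show ?case by (simp add: L2_add)
qed (simp_all add: L2_def)

lemma L2_indicator:
  assumes "f \<in> L2" "A \<in> sets lebesgue"
  shows "(\<lambda>x. indicator A x * f x) \<in> L2"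
proof (rule L2_bound)
  show "(\<lambda>x. indicator A x * f x) \<in> borel_measurable lebesgue"
    using assms(1)[THEN L2_measurable] assms(2) by measurable
  show "integrable lebesgue (\<lambda>x. (cmod (f x))\<^sup>2)"
    using assms(1) by (rule L2_integrable)
qed (auto simp: indicator_def)

lemma L2_mult_integrable:
  assumes "f \<in> L2" "g \<in> L2"
  shows "integrable lebesgue (\<lambda>x. f x * cnj (g x))"
proof (rule Bochner_Integration.integrable_bound)
  show "integrable lebesgue (\<lambda>x. (cmod (f x))\<^sup>2 + (cmod (g x))\<^sup>2)"
    using assms[THEN L2_integrable] by auto
  show "(\<lambda>x. f x * cnj (g x)) \<in> borel_measurable lebesgue"
    using assms[THEN L2_measurable] by (intro borel_measurable_times measurable_compose[OF _ borel_measurable_continuous_onI[of cnj]])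
      (auto intro!: continuous_intros)
  have "norm (a * cnj b) \<le> norm ((cmod a)\<^sup>2 + (cmod b)\<^sup>2)" for a b
  proof -
    have "0 \<le> (cmod a)\<^sup>2 + (cmod b)\<^sup>2" by simp
    moreover have "2 * (cmod a * cmod b) \<le> (cmod a)\<^sup>2 + (cmod b)\<^sup>2"
      using sum_squares_bound[of "cmod a" "cmod b"] by (simp add: mult.assoc)
    moreover have "0 \<le> cmod a * cmod b" by simp
    ultimately show ?thesis unfolding norm_mult complex_mod_cnj real_norm_def by linarith
  qed
  then show "AE x in lebesgue. norm (f x * cnj (g x)) \<le> norm ((cmod (f x))\<^sup>2 + (cmod (g x))\<^sup>2)"
    by simp
qed

text \<open>Integrating the weighted inequality with weight \<open>b / a\<close> bounds the squared
  norm of the sum by the perfect square \<open>(a + b)\<^sup>2\<close>, so Cauchy-Schwarz is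
  bypassed.\<close>

lemma L2_norm_triangle:
  assumes f: "f \<in> L2" and g: "g \<in> L2"
  shows "L2_norm (\<lambda>x. f x + g x) \<le> L2_norm f + L2_norm g"
proof (rule field_le_epsilon)
  fix d :: real assume "d > 0"
  \<comment> \<open>Both norms are enlarged by \<open>d / 2\<close> so that the ratio
    \<open>b / a\<close> makes sense even when a norm vanishes.\<close>
  define a b where "a = L2_norm f + d / 2" and "b = L2_norm g + d / 2"
  have pos: "a > 0" "b > 0" "L2_norm f \<le> a" "L2_norm g \<le> b"
    using \<open>d > 0\<close> L2_norm_nonneg[of f] L2_norm_nonneg[of g] by (auto simp: a_def b_def)
  have "(L2_norm (\<lambda>x. f x + g x))\<^sup>2
      \<le> (LINT x|lebesgue. (1 + b / a) * (cmod (f x))\<^sup>2 + (1 + 1 / (b / a)) * (cmod (g x))\<^sup>2)"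
    unfolding L2_norm_square
  proof (rule integral_mono)
    show "(cmod (f x + g x))\<^sup>2 \<le> (1 + b / a) * (cmod (f x))\<^sup>2 + (1 + 1 / (b / a)) * (cmod (g x))\<^sup>2" for x
      using pos by (intro cmod_add_square_le) simp
  qed (use f g in \<open>simp_all add: L2_integrable L2_add\<close>)
  also have "\<dots> = (1 + b / a) * (L2_norm f)\<^sup>2 + (1 + a / b) * (L2_norm g)\<^sup>2"
    using f g by (simp add: L2_integrable L2_norm_square)
  also have "\<dots> \<le> (1 + b / a) * a\<^sup>2 + (1 + a / b) * b\<^sup>2"
    using pos by (intro add_mono mult_left_mono power_mono) (auto simp: L2_norm_nonneg)
  also have "\<dots> = (a + b)\<^sup>2"
    using pos by (simp add: field_simps power2_eq_square)
  finally have "L2_norm (\<lambda>x. f x + g x) \<le> a + b"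
    using pos by (meson add_nonneg_nonneg less_imp_le power2_le_imp_le)
  then show "L2_norm (\<lambda>x. f x + g x) \<le> L2_norm f + L2_norm g + d"
    by (simp add: a_def b_def)
qed

lemma L2_norm_minus_commute: "L2_norm (\<lambda>x. f x - g x) = L2_norm (\<lambda>x. g x - f x)"
  by (simp add: L2_norm_def norm_minus_commute)

lemma L2_norm_triangle_diff:
  assumes "f \<in> L2" "g \<in> L2" "h \<in> L2"
  shows "L2_norm (\<lambda>x. f x - h x) \<le> L2_norm (\<lambda>x. f x - g x) + L2_norm (\<lambda>x. g x - h x)"
  using L2_norm_triangle[OF L2_diff[OF assms(1,2)] L2_diff[OF assms(2,3)]] by simp

text \<open>With \<open>s\<close> the projection of \<open>h\<close> onto the span of the family,
  both \<open>L2_inner h s\<close> and \<open>L2_inner s s\<close> equal the sum of the squared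
  coefficients. Hence the squared norm of \<open>h - s\<close> is the difference of the two sides,
  and it is nonnegative.\<close>

lemma L2_bessel:
  assumes "finite I" and orth: "L2_orthonormal I e" and h: "h \<in> L2"
  shows "(\<Sum>i\<in>I. (cmod (L2_inner h (e i)))\<^sup>2) \<le> (LINT x|lebesgue. (cmod (h x))\<^sup>2)"
proof -
  define c where "c i = L2_inner h (e i)" for i
  define s where "s x = (\<Sum>i\<in>I. c i * e i x)" for x
  have e: "e i \<in> L2" if "i \<in> I" for i
    using orth that by (auto simp: L2_orthonormal_def)
  have s: "s \<in> L2" unfolding s_def by (intro L2_sum L2_cmult e)
  note int = L2_mult_integrable
  have hs: "L2_inner h s = (\<Sum>i\<in>I. (cmod (c i))\<^sup>2)"
  proof -
    have "L2_inner h s = (LINT x|lebesgue. (\<Sum>i\<in>I. cnj (c i) * (h x * cnj (e i x))))"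
      unfolding L2_inner_def s_def by (simp add: sum_distrib_left mult_ac)
    also have "\<dots> = (\<Sum>i\<in>I. cnj (c i) * c i)"
      using e h by (subst Bochner_Integration.integral_sum)
        (auto intro!: int simp: c_def L2_inner_def)
    finally show ?thesis by (simp add: complex_norm_square mult.commute del: of_real_power)
  qed
  have es: "L2_inner s (e j) = c j" if "j \<in> I" for j
  proof -
    have "L2_inner s (e j) = (LINT x|lebesgue. (\<Sum>i\<in>I. c i * (e i x * cnj (e j x))))"
      unfolding L2_inner_def s_def by (simp add: sum_distrib_right mult.assoc)
    also have "\<dots> = (\<Sum>i\<in>I. c i * L2_inner (e i) (e j))"
      using e that by (subst Bochner_Integration.integral_sum)
        (auto intro!: int simp: c_def L2_inner_def)
    also have "\<dots> = (\<Sum>i\<in>I. if i = j then c i else 0)"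
      using orth that by (intro sum.cong) (auto simp: L2_orthonormal_def)
    finally show ?thesis using that assms(1) by simp
  qed
  have ss: "L2_inner s s = (\<Sum>i\<in>I. (cmod (c i))\<^sup>2)"
  proof -
    have "L2_inner s s = (LINT x|lebesgue. (\<Sum>i\<in>I. cnj (c i) * (s x * cnj (e i x))))"
      unfolding L2_inner_def by (subst (2) s_def) (simp add: sum_distrib_left mult_ac)
    also have "\<dots> = (\<Sum>i\<in>I. cnj (c i) * L2_inner s (e i))"
      using e s by (subst Bochner_Integration.integral_sum) (auto intro!: int simp: L2_inner_def)
    also have "\<dots> = (\<Sum>i\<in>I. cnj (c i) * c i)"
      using es by simp
    finally show ?thesis by (simp add: complex_norm_square mult.commute del: of_real_power)
  qed
  have "(cmod (h x - s x))\<^sup>2 = (cmod (h x))\<^sup>2 - 2 * Re (h x * cnj (s x)) + Re (s x * cnj (s x))" for x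
    unfolding cmod_power2 by (simp add: power2_eq_square algebra_simps)
  then have "(LINT x|lebesgue. (cmod (h x - s x))\<^sup>2)
      = (LINT x|lebesgue. (cmod (h x))\<^sup>2 - 2 * Re (h x * cnj (s x)) + Re (s x * cnj (s x)))"
    by simp
  also have "\<dots> = (LINT x|lebesgue. (cmod (h x))\<^sup>2) - 2 * Re (L2_inner h s) + Re (L2_inner s s)"
    unfolding L2_inner_def
    using L2_integrable[OF h] int[OF h s] int[OF s s]
    by (simp del: times_complex.simps complex_cnj)
  also have "\<dots> = (LINT x|lebesgue. (cmod (h x))\<^sup>2) - (\<Sum>i\<in>I. (cmod (c i))\<^sup>2)"
    by (simp add: hs ss)
  finally have "0 \<le> (LINT x|lebesgue. (cmod (h x))\<^sup>2) - (\<Sum>i\<in>I. (cmod (c i))\<^sup>2)"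
    using Bochner_Integration.integral_nonneg[of lebesgue "\<lambda>x. (cmod (h x - s x))\<^sup>2"] by simp
  then show ?thesis by (simp add: c_def)
qed

section \<open>Continuity of translation in the mean\<close>

lemma integrable_lborel_shift:
  fixes f :: "real \<Rightarrow> 'b::{banach, second_countable_topology}"
  assumes "integrable lborel f"
  shows "integrable lborel (\<lambda>t. f (t - u))"
  using lborel_integrable_real_affine[OF assms, of 1 "- u"] by simp

lemma integral_lborel_shift:
  fixes f :: "real \<Rightarrow> 'b::{banach, second_countable_topology}"
  shows "(LINT t|lborel. f (t - u)) = (LINT t|lborel. f t)"
  using lborel_integral_real_affine[of 1 f "- u"] by simp

text \<open>A three-epsilon argument: translation preserves the L1 norm, so replacing
  \<open>f\<close> by \<open>g\<close> costs the same small error before and after the shift. It is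
  applied twice below, to pass from open to measurable sets and from simple to integrable
  functions.\<close>

lemma L1_translation_closure:
  fixes f :: "real \<Rightarrow> 'b::{banach, second_countable_topology}"
  assumes f: "integrable lborel f"
    and approx: "\<And>\<epsilon>. 0 < \<epsilon> \<Longrightarrow> \<exists>g. integrable lborel g \<and> (LINT t|lborel. norm (f t - g t)) < \<epsilon> \<and>
      (\<lambda>n. LINT t|lborel. norm (g (t - X n) - g t)) \<longlonglongrightarrow> 0"
  shows "(\<lambda>n. LINT t|lborel. norm (f (t - X n) - f t)) \<longlonglongrightarrow> 0"
proof (rule LIMSEQ_I)
  fix \<epsilon> :: real assume "0 < \<epsilon>"
  obtain g where g: "integrable lborel g" "(LINT t|lborel. norm (f t - g t)) < \<epsilon> / 3"
      "(\<lambda>n. LINT t|lborel. norm (g (t - X n) - g t)) \<longlonglongrightarrow> 0"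
    using approx[of "\<epsilon> / 3"] \<open>0 < \<epsilon>\<close> by auto
  obtain n0 where n0: "\<And>n. n \<ge> n0 \<Longrightarrow> (LINT t|lborel. norm (g (t - X n) - g t)) < \<epsilon> / 3"
    using LIMSEQ_D[OF g(3), of "\<epsilon> / 3"] \<open>0 < \<epsilon>\<close> by auto
  have "(LINT t|lborel. norm (f (t - X n) - f t)) < \<epsilon>" if "n \<ge> n0" for n
  proof -
    note int = f g(1) integrable_lborel_shift[OF f, of "X n"] integrable_lborel_shift[OF g(1), of "X n"]
    have "(LINT t|lborel. norm (f (t - X n) - f t))
        \<le> (LINT t|lborel. norm (f (t - X n) - g (t - X n)) + norm (g (t - X n) - g t) + norm (f t - g t))"
    proof (rule integral_mono)
      show "norm (f (t - X n) - f t)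
          \<le> norm (f (t - X n) - g (t - X n)) + norm (g (t - X n) - g t) + norm (f t - g t)" for t
        using norm_triangle_ineq[of "f (t - X n) - g (t - X n)" "g (t - X n) - g t"]
          norm_triangle_ineq[of "f (t - X n) - g t" "g t - f t"]
        by (simp add: norm_minus_commute)
    qed (use int in auto)
    also have "\<dots> = (LINT t|lborel. norm (f (t - X n) - g (t - X n)))
        + (LINT t|lborel. norm (g (t - X n) - g t)) + (LINT t|lborel. norm (f t - g t))"
      using int by (subst Bochner_Integration.integral_add | simp)+
    also have "(LINT t|lborel. norm (f (t - X n) - g (t - X n))) = (LINT t|lborel. norm (f t - g t))"
      by (rule integral_lborel_shift[of "\<lambda>t. norm (f t - g t)"])
    finally show ?thesis using g(2) n0[OF that] by simp
  qed
  then show "\<exists>n0. \<forall>n\<ge>n0. norm ((LINT t|lborel. norm (f (t - X n) - f t)) - 0) < \<epsilon>"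
    by (auto intro!: exI[of _ n0])
qed

text \<open>The positive part of \<open>1\<^sub>U(t) - 1\<^sub>U(t - u)\<close> tends to \<open>0\<close> pointwise because \<open>U\<close> is open, and the
  positive and negative parts have the same integral.\<close>

lemma L1_translation_open:
  fixes U :: "real set"
  assumes U: "open U" "emeasure lborel U < \<infinity>" and X: "X \<longlonglongrightarrow> 0"
  shows "(\<lambda>n. LINT t|lborel. \<bar>indicat_real U (t - X n) - indicat_real U t\<bar>) \<longlonglongrightarrow> 0"
proof -
  have [measurable]: "U \<in> sets borel" using U(1) by simp
  have int: "integrable lborel (indicat_real U)"
    using U by (simp add: integrable_indicator_iff)
  note int' = integrable_lborel_shift[OF int]
  have "(\<lambda>n. LINT t|lborel. max 0 (indicat_real U t - indicat_real U (t - X n))) \<longlonglongrightarrow> (LINT t::real|lborel. 0)"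
  proof (rule integral_dominated_convergence[where w = "indicat_real U"])
    have "(\<lambda>n. max 0 (indicat_real U t - indicat_real U (t - X n))) \<longlonglongrightarrow> 0" for t
    proof (cases "t \<in> U")
      case True
      have "(\<lambda>n. t - X n) \<longlonglongrightarrow> t" using tendsto_diff[OF tendsto_const X, of t] by simp
      then have "eventually (\<lambda>n. t - X n \<in> U) sequentially"
        using U(1) True by (rule topological_tendstoD)
      then have "eventually (\<lambda>n. max 0 (indicat_real U t - indicat_real U (t - X n)) = 0) sequentially"
        by eventually_elim (simp add: True)
      then show ?thesis by (rule tendsto_eventually)
    next
      case False
      then show ?thesis by (simp add: indicator_def)
    qed
    then show "AE t in lborel. (\<lambda>n. max 0 (indicat_real U t - indicat_real U (t - X n))) \<longlonglongrightarrow> 0"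
      by simp
  qed (use int in \<open>auto simp: indicator_def\<close>)
  then have lim: "(\<lambda>n. 2 * (LINT t|lborel. max 0 (indicat_real U t - indicat_real U (t - X n)))) \<longlonglongrightarrow> 0"
    using tendsto_mult_right_zero by fastforce
  have "(LINT t|lborel. \<bar>indicat_real U (t - X n) - indicat_real U t\<bar>)
      = 2 * (LINT t|lborel. max 0 (indicat_real U t - indicat_real U (t - X n)))" for n
  proof -
    have m: "integrable lborel (\<lambda>t. max 0 (indicat_real U t - indicat_real U (t - X n)))"
      using int int'[of "X n"] by (intro integrable_max) auto
    have "(LINT t|lborel. \<bar>indicat_real U (t - X n) - indicat_real U t\<bar>)
       = (LINT t|lborel. 2 * max 0 (indicat_real U t - indicat_real U (t - X n))
            + (indicat_real U (t - X n) - indicat_real U t))"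
      by (rule Bochner_Integration.integral_cong) (auto simp: max_def)
    also have "\<dots> = 2 * (LINT t|lborel. max 0 (indicat_real U t - indicat_real U (t - X n)))
        + ((LINT t|lborel. indicat_real U (t - X n)) - (LINT t|lborel. indicat_real U t))"
      using m int int'[of "X n"] by (subst Bochner_Integration.integral_add) auto
    also have "(LINT t|lborel. indicat_real U (t - X n)) = (LINT t|lborel. indicat_real U t)"
      by (rule integral_lborel_shift)
    finally show ?thesis by simp
  qed
  with lim show ?thesis by simp
qed

text \<open>Induction over integrable functions. Outer regularity reduces indicators of measurable
  sets to indicators of open sets, the triangle inequality handles sums, and L1 approximation
  handles limits.\<close>

lemma L1_translation_continuous:
  fixes f :: "real \<Rightarrow> 'b::{banach, second_countable_topology}"
  assumes "integrable lborel f" and X: "X \<longlonglongrightarrow> 0"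
  shows "(\<lambda>n. LINT t|lborel. norm (f (t - X n) - f t)) \<longlonglongrightarrow> 0"
  using assms(1)
proof (induction rule: integrable_induct)
  case (base A c)
  then have A: "A \<in> sets lebesgue" and [measurable]: "A \<in> sets borel" by auto
  show ?case
  proof (rule L1_translation_closure)
    show "integrable lborel (\<lambda>x. indicat_real A x *\<^sub>R c)"
      using base by (intro integrable_scaleR_left) (simp add: integrable_indicator_iff)
    fix \<epsilon> :: real assume "0 < \<epsilon>"
    \<comment> \<open>The denominator \<open>norm c + 1\<close> covers \<open>c = 0\<close> as
      well.\<close>
    define \<delta> where "\<delta> = \<epsilon> / (norm c + 1)"
    have "\<delta> > 0" using \<open>0 < \<epsilon>\<close> by (simp add: \<delta>_def add_nonneg_pos)
    obtain U where U: "open U" "A \<subseteq> U" "emeasure lebesgue (U - A) < ennreal \<delta>"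
      using sets_lebesgue_outer_open[OF A \<open>\<delta> > 0\<close>] by metis
    have [measurable]: "U \<in> sets borel" using U(1) by simp
    have d: "emeasure lborel (U - A) < ennreal \<delta>" using U(3) by simp
    have "emeasure lborel U = emeasure lborel A + emeasure lborel (U - A)"
      using U(2) by (subst plus_emeasure) (auto simp: Un_absorb1)
    then have fin: "emeasure lborel U < \<infinity>"
      using base(2) d by (auto simp: less_top[symmetric])
    have intU: "integrable lborel (indicat_real U)"
      using fin by (simp add: integrable_indicator_iff)
    have "(LINT t|lborel. norm (indicat_real A t *\<^sub>R c - indicat_real U t *\<^sub>R c))
        = (LINT t|lborel. indicat_real (U - A) t * norm c)"
      by (rule Bochner_Integration.integral_cong) (use U(2) in \<open>auto simp: indicator_def\<close>)
    also have "\<dots> = measure lborel (U - A) * norm c"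
      by simp
    also have "\<dots> \<le> \<delta> * norm c"
      using d \<open>\<delta> > 0\<close> by (intro mult_right_mono)
        (auto simp: measure_def enn2real_leI less_imp_le)
    also have "\<dots> < \<epsilon>"
      using \<open>0 < \<epsilon>\<close> pos_divide_less_eq[of "norm c + 1" "\<epsilon> * norm c" \<epsilon>]
      by (simp add: \<delta>_def algebra_simps add_nonneg_pos add_pos_nonneg)
    finally have le: "(LINT t|lborel. norm (indicat_real A t *\<^sub>R c - indicat_real U t *\<^sub>R c)) < \<epsilon>" .
    have "(\<lambda>n. LINT t|lborel. norm (indicat_real U (t - X n) *\<^sub>R c - indicat_real U t *\<^sub>R c)) \<longlonglongrightarrow> 0"
      using tendsto_mult_left_zero[OF L1_translation_open[OF U(1) fin X], of "norm c"]
      by (simp flip: scaleR_left_diff_distrib)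
    with le intU show "\<exists>g. integrable lborel g \<and>
        (LINT t|lborel. norm (indicat_real A t *\<^sub>R c - g t)) < \<epsilon> \<and>
        (\<lambda>n. LINT t|lborel. norm (g (t - X n) - g t)) \<longlonglongrightarrow> 0"
      by (intro exI[of _ "\<lambda>t. indicat_real U t *\<^sub>R c"]) auto
  qed
next
  case (add f g)
  note int = add(1,2) integrable_lborel_shift[OF add(1)] integrable_lborel_shift[OF add(2)]
  have lim0: "(\<lambda>n. (LINT t|lborel. norm (f (t - X n) - f t)) + (LINT t|lborel. norm (g (t - X n) - g t))) \<longlonglongrightarrow> 0"
    using tendsto_add[OF add(3,4)] by simp
  have le: "(LINT t|lborel. norm (f (t - X n) + g (t - X n) - (f t + g t)))
      \<le> (LINT t|lborel. norm (f (t - X n) - f t)) + (LINT t|lborel. norm (g (t - X n) - g t))" for n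
  proof -
    have "(LINT t|lborel. norm (f (t - X n) + g (t - X n) - (f t + g t)))
       \<le> (LINT t|lborel. norm (f (t - X n) - f t) + norm (g (t - X n) - g t))"
      by (rule integral_mono) (use int in \<open>auto intro: norm_diff_triangle_ineq\<close>)
    also have "\<dots> = (LINT t|lborel. norm (f (t - X n) - f t)) + (LINT t|lborel. norm (g (t - X n) - g t))"
      using int by (subst Bochner_Integration.integral_add) auto
    finally show ?thesis .
  qed
  show ?case
    by (rule tendsto_sandwich[OF _ _ tendsto_const lim0]) (simp_all add: le)
next
  case (lim f s)
  show ?case
  proof (rule L1_translation_closure[OF lim.hyps(4)])
    fix \<epsilon> :: real assume "0 < \<epsilon>"
    have "(\<lambda>i. LINT t|lborel. norm (f t - s i t)) \<longlonglongrightarrow> (LINT t::real|lborel. 0)"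
    \<comment> \<open>The approximants satisfy \<open>norm (s i t) \<le> 2 * norm (f t)\<close>,
      whence the factor 3.\<close>
    proof (rule integral_dominated_convergence[where w = "\<lambda>t. 3 * norm (f t)"])
      show "AE t in lborel. (\<lambda>i. norm (f t - s i t)) \<longlonglongrightarrow> 0"
      proof (rule AE_I2)
        fix t :: real
        have "(\<lambda>i. s i t) \<longlonglongrightarrow> f t" using lim.hyps(2) by simp
        from tendsto_norm[OF tendsto_diff[OF tendsto_const[of "f t"] this]]
        show "(\<lambda>i. norm (f t - s i t)) \<longlonglongrightarrow> 0" by simp
      qed
      show "AE t in lborel. norm (norm (f t - s i t)) \<le> 3 * norm (f t)" for i
      proof (rule AE_I2)
        fix t :: real
        show "norm (norm (f t - s i t)) \<le> 3 * norm (f t)"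
          using norm_triangle_ineq4[of "f t" "s i t"] lim.hyps(3)[of t i] by simp
      qed
    qed (use lim.hyps(1,4) in auto)
    then have "(\<lambda>i. LINT t|lborel. norm (f t - s i t)) \<longlonglongrightarrow> 0" by simp
    from LIMSEQ_D[OF this \<open>0 < \<epsilon>\<close>] obtain i where "(LINT t|lborel. norm (f t - s i t)) < \<epsilon>"
      by force
    then show "\<exists>g. integrable lborel g \<and> (LINT t|lborel. norm (f t - g t)) < \<epsilon> \<and>
        (\<lambda>n. LINT t|lborel. norm (g (t - X n) - g t)) \<longlonglongrightarrow> 0"
      using lim.hyps(1) lim.IH by blast
  qed
qed

section \<open>Fourier transforms of integrable functions\<close>

lemma borel_measurable_cis [measurable (raw)]:
  "f \<in> borel_measurable M \<Longrightarrow> (\<lambda>x. cis (f x)) \<in> borel_measurable M"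
  by (rule measurable_compose[OF _ borel_measurable_continuous_onI]) (auto intro!: continuous_intros)

lemma borel_measurable_cnj [measurable (raw)]:
  "f \<in> borel_measurable M \<Longrightarrow> (\<lambda>x. cnj (f x)) \<in> borel_measurable M"
  by (rule measurable_compose[OF _ borel_measurable_continuous_onI]) (auto intro!: continuous_intros)

lemma integrable_cis_mult:
  fixes f :: "real \<Rightarrow> complex"
  assumes "integrable M f" "g \<in> borel_measurable M"
  shows "integrable M (\<lambda>t. f t * cis (g t))"
  by (rule Bochner_Integration.integrable_bound[OF assms(1)])
     (use assms in \<open>auto simp: norm_mult\<close>)

lemma integrable_pair_mult:
  fixes f g :: "real \<Rightarrow> complex"
  assumes f: "integrable lborel f" and g: "integrable lborel g"
  shows "integrable (lborel \<Otimes>\<^sub>M lborel) (\<lambda>(x, y). f x * g y)"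
proof (rule lborel_pair.Fubini_integrable)
  have [measurable]: "f \<in> borel_measurable borel" "g \<in> borel_measurable borel"
    using f g by (simp_all add: borel_measurable_integrable)
  show "(\<lambda>(x, y). f x * g y) \<in> borel_measurable (lborel \<Otimes>\<^sub>M lborel)"
    by measurable
qed (use f g in \<open>auto simp: norm_mult\<close>)

text \<open>The substitution of \<open>t - u\<close> for \<open>u\<close> preserves Lebesgue
  measure, so integrating the modulus over \<open>u\<close> leaves \<open>norm (f t)\<close> times
  the L1 norm of \<open>g\<close>. This justifies the use of Fubini for autocorrelations.\<close>

lemma integrable_pair_shift_mult:
  fixes f g :: "real \<Rightarrow> complex"
  assumes f: "integrable lborel f" and g: "integrable lborel g"
  shows "integrable (lborel \<Otimes>\<^sub>M lborel) (\<lambda>(t, u). f t * g (t - u))"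
proof (rule lborel_pair.Fubini_integrable)
  have [measurable]: "f \<in> borel_measurable borel" "g \<in> borel_measurable borel"
    using f g by (simp_all add: borel_measurable_integrable)
  have g': "integrable lborel (\<lambda>u. g (t - u))" for t
    using lborel_integrable_real_affine[OF g, of "-1" t] by simp
  have "(LINT u|lborel. norm (g (t - u))) = (LINT u|lborel. norm (g u))" for t
    using lborel_integral_real_affine[of "-1" "\<lambda>u. norm (g u)" t] by simp
  then show "integrable lborel (\<lambda>t. LINT u|lborel. norm (case (t, u) of (t, u) \<Rightarrow> f t * g (t - u)))"
    using f by (auto simp: norm_mult)
  show "(\<lambda>(t, u). f t * g (t - u)) \<in> borel_measurable (lborel \<Otimes>\<^sub>M lborel)"
    by measurable
  show "AE t in lborel. integrable lborel (\<lambda>u. case (t, u) of (t, u) \<Rightarrow> f t * g (t - u))"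
    using g' by simp
qed

section \<open>Elementary properties of the transform on integrable functions\<close>

lemma fourier_L1_eq_cis:
  "fourier_L1 f \<xi> = (LINT t|lebesgue. f t * cis (- 2 * pi * t * \<xi>))"
  unfolding fourier_L1_def cis_conv_exp by (simp add: mult_ac)

lemma fourier_L1_eq_lborel:
  assumes [measurable]: "f \<in> borel_measurable borel"
  shows "fourier_L1 f \<xi> = (LINT t|lborel. f t * cis (- 2 * pi * t * \<xi>))"
  unfolding fourier_L1_eq_cis by (rule integral_completion) simp

lemma borel_measurable_fourier_L1 [measurable]:
  assumes [measurable]: "f \<in> borel_measurable borel"
  shows "fourier_L1 f \<in> borel_measurable borel"
  unfolding fourier_L1_eq_lborel[OF assms, abs_def] by measurable

lemma norm_fourier_L1_le:
  "cmod (fourier_L1 f \<xi>) \<le> (LINT t|lebesgue. cmod (f t))"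
  unfolding fourier_L1_eq_cis
  by (rule order_trans[OF integral_norm_bound]) (simp add: norm_mult)

text \<open>This is the convolution of \<open>f\<close> with its conjugate reflection
  \<open>\<lambda>t. cnj (f (- t))\<close>. The value at 0 is the squared L2 norm, which is how that
  norm enters Plancherel.\<close>

definition autocorrelation :: "(real \<Rightarrow> complex) \<Rightarrow> real \<Rightarrow> complex" where
  "autocorrelation f u = (LINT t|lborel. f t * cnj (f (t - u)))"

lemma borel_measurable_autocorrelation [measurable]:
  assumes [measurable]: "f \<in> borel_measurable borel"
  shows "autocorrelation f \<in> borel_measurable borel"
  unfolding autocorrelation_def[abs_def] by measurable

lemma integrable_autocorrelation:
  assumes "integrable lborel f"
  shows "integrable lborel (autocorrelation f)"
proof -
  have "integrable lborel (\<lambda>t. cnj (f t))" using assms by simp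
  from lborel_pair.integrable_snd[OF integrable_pair_shift_mult[OF assms this]]
  show ?thesis unfolding autocorrelation_def[abs_def] by simp
qed

text \<open>The convolution theorem in this special case. The character factors as
  \<open>E u = E t * cnj (E (t - u))\<close>, so the double integral becomes the one for
  \<open>f\<close> times \<open>E\<close>, and Fubini splits it into a transform times its
  conjugate.\<close>

lemma fourier_autocorrelation:
  assumes f: "integrable lborel f"
  shows "fourier_L1 (autocorrelation f) \<xi> = (cmod (fourier_L1 f \<xi>))\<^sup>2"
proof -
  have [measurable]: "f \<in> borel_measurable borel"
    using f by (simp add: borel_measurable_integrable)
  define E where "E t = cis (- 2 * pi * t * \<xi>)" for t
  have [measurable]: "E \<in> borel_measurable borel" unfolding E_def[abs_def] by measurable
  have fE: "integrable lborel (\<lambda>t. f t * E t)"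
    unfolding E_def by (rule integrable_cis_mult[OF f]) simp
  then have fE': "integrable lborel (\<lambda>t. cnj (f t * E t))" by (rule integrable_cnj)
  have FE: "fourier_L1 f \<xi> = (LINT t|lborel. f t * E t)"
    by (simp add: fourier_L1_eq_lborel E_def)
  have E: "E u = E t * cnj (E (t - u))" for t u
    by (simp add: E_def cis_cnj cis_mult algebra_simps)
  have "fourier_L1 (autocorrelation f) \<xi> = (LINT u|lborel. (LINT t|lborel. (f t * E t) * cnj (f (t - u) * E (t - u))))"
    unfolding fourier_L1_eq_lborel[OF borel_measurable_autocorrelation[OF \<open>f \<in> borel_measurable borel\<close>]]
  proof (rule Bochner_Integration.integral_cong[OF refl])
    fix u
    have "autocorrelation f u * cis (- 2 * pi * u * \<xi>) = (LINT t|lborel. f t * cnj (f (t - u)) * E u)"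
      by (simp add: autocorrelation_def E_def)
    also have "\<dots> = (LINT t|lborel. (f t * E t) * cnj (f (t - u) * E (t - u)))"
    proof (rule Bochner_Integration.integral_cong[OF refl])
      show "f t * cnj (f (t - u)) * E u = (f t * E t) * cnj (f (t - u) * E (t - u))" for t
        unfolding E[of u t] by simp
    qed
    finally show "autocorrelation f u * cis (- 2 * pi * u * \<xi>)
      = (LINT t|lborel. (f t * E t) * cnj (f (t - u) * E (t - u)))" .
  qed
  also have "\<dots> = (LINT t|lborel. (LINT u|lborel. (f t * E t) * cnj (f (t - u) * E (t - u))))"
    by (rule lborel_pair.Fubini_integral) (rule integrable_pair_shift_mult[OF fE fE'])
  also have "\<dots> = (LINT t|lborel. (f t * E t) * cnj (fourier_L1 f \<xi>))"
  proof (rule Bochner_Integration.integral_cong[OF refl])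
    fix t
    have "(LINT u|lborel. cnj (f (t - u) * E (t - u))) = (LINT u|lborel. cnj (f u * E u))"
      using lborel_integral_real_affine[of "-1" "\<lambda>u. cnj (f u * E u)" t] by simp
    also have "\<dots> = cnj (fourier_L1 f \<xi>)"
      unfolding FE by (simp del: complex_cnj_mult)
    finally show "(LINT u|lborel. (f t * E t) * cnj (f (t - u) * E (t - u))) = (f t * E t) * cnj (fourier_L1 f \<xi>)"
      by simp
  qed
  also have "\<dots> = fourier_L1 f \<xi> * cnj (fourier_L1 f \<xi>)"
    unfolding FE by (rule integral_mult_left_zero)
  also have "\<dots> = (cmod (fourier_L1 f \<xi>))\<^sup>2"
    by (rule complex_norm_square[symmetric])
  finally show ?thesis .
qed

text \<open>A rescaled form of the characteristic function of the standard normal law. The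
  right-hand side is the normal density with standard deviation \<open>\<tau>\<close>, an
  approximate identity as \<open>\<tau>\<close> tends to 0.\<close>

lemma fourier_gaussian:
  assumes "\<tau> > 0"
  shows "(LINT \<xi>|lborel. complex_of_real (exp (- (2 * pi * \<tau> * \<xi>)\<^sup>2 / 2)) * cis (- 2 * pi * u * \<xi>))
       = complex_of_real (std_normal_density (u / \<tau>) / \<tau>)"
proof -
  \<comment> \<open>Substituting \<open>c * x\<close> for the frequency turns the Gaussian exponent
    into \<open>- x\<^sup>2 / 2\<close> and the phase into
    \<open>- (u / \<tau>) * x\<close>.\<close>
  define c where "c = 1 / (2 * pi * \<tau>)"
  have c: "c > 0" using assms by (simp add: c_def)
  have "char std_normal_distribution (- (u / \<tau>))
      = (LINT x|lborel. std_normal_density x *\<^sub>R iexp (- (u / \<tau>) * x))"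
    unfolding char_def by (subst integral_density) auto
  then have char: "(LINT x|lborel. std_normal_density x *\<^sub>R iexp (- (u / \<tau>) * x))
      = complex_of_real (exp (- (u / \<tau>)\<^sup>2 / 2))"
    by (simp add: char_std_normal_distribution)
  have s: "sqrt (2 * pi) * sqrt (2 * pi) = 2 * pi" by simp
  have "(LINT \<xi>|lborel. complex_of_real (exp (- (2 * pi * \<tau> * \<xi>)\<^sup>2 / 2)) * cis (- 2 * pi * u * \<xi>))
     = c *\<^sub>R (LINT x|lborel. complex_of_real (exp (- (2 * pi * \<tau> * (c * x))\<^sup>2 / 2)) * cis (- 2 * pi * u * (c * x)))"
    using c by (subst lborel_integral_real_affine[of c _ 0]) simp_all
  also have "(\<lambda>x. complex_of_real (exp (- (2 * pi * \<tau> * (c * x))\<^sup>2 / 2)) * cis (- 2 * pi * u * (c * x)))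
     = (\<lambda>x. sqrt (2 * pi) *\<^sub>R (std_normal_density x *\<^sub>R iexp (- (u / \<tau>) * x)))"
  proof
    fix x
    have eq: "2 * pi * \<tau> * (c * x) = x" "- 2 * pi * u * (c * x) = - (u / \<tau>) * x"
      using assms by (simp_all add: c_def)
    then show "complex_of_real (exp (- (2 * pi * \<tau> * (c * x))\<^sup>2 / 2)) * cis (- 2 * pi * u * (c * x))
      = sqrt (2 * pi) *\<^sub>R (std_normal_density x *\<^sub>R iexp (- (u / \<tau>) * x))"
      unfolding eq by (simp add: std_normal_density_def cis_conv_exp scaleR_conv_of_real)
  qed
  also have "c *\<^sub>R (LINT x|lborel. sqrt (2 * pi) *\<^sub>R (std_normal_density x *\<^sub>R iexp (- (u / \<tau>) * x)))
     = complex_of_real (c * sqrt (2 * pi) * exp (- (u / \<tau>)\<^sup>2 / 2))"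
    unfolding integral_scaleR_right char by (simp add: scaleR_conv_of_real)
  also have "c * sqrt (2 * pi) * exp (- (u / \<tau>)\<^sup>2 / 2) = std_normal_density (u / \<tau>) / \<tau>"
  proof -
    have "c * sqrt (2 * pi) = 1 / sqrt (2 * pi) / \<tau>"
      using assms s unfolding c_def by (simp add: field_simps del: real_sqrt_mult)
    then show ?thesis by (simp add: std_normal_density_def)
  qed
  finally show ?thesis .
qed

lemma integrable_gaussian:
  assumes "\<tau> > 0"
  shows "integrable lborel (\<lambda>\<xi>. exp (- (2 * pi * \<tau> * \<xi>)\<^sup>2 / 2))"
proof -
  have "integrable lborel (\<lambda>x. sqrt (2 * pi) * std_normal_density (0 + (2 * pi * \<tau>) * x))"
    using assms by (intro integrable_mult_right lborel_integrable_real_affine) auto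
  then show ?thesis by (simp add: std_normal_density_def)
qed

text \<open>Writing the squared modulus as the transform of the autocorrelation and exchanging
  integrals moves the transform onto the Gaussian. The final substitution
  \<open>u = \<tau> * v\<close> leaves \<open>\<tau>\<close> only in the argument of the
  autocorrelation, where the limit at 0 can be taken under a fixed probability density.\<close>

lemma fourier_gaussian_summation:
  assumes f: "integrable lborel f" and \<tau>: "\<tau> > 0"
  shows "(LINT \<xi>|lborel. complex_of_real ((cmod (fourier_L1 f \<xi>))\<^sup>2 * exp (- (2 * pi * \<tau> * \<xi>)\<^sup>2 / 2)))
       = (LINT v|lborel. std_normal_density v * autocorrelation f (\<tau> * v))"
proof -
  have [measurable]: "f \<in> borel_measurable borel"
    using f by (simp add: borel_measurable_integrable)
  let ?w = "\<lambda>\<xi>. complex_of_real (exp (- (2 * pi * \<tau> * \<xi>)\<^sup>2 / 2))"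
  let ?R = "autocorrelation f"
  have w: "integrable lborel ?w"
    using integrable_gaussian[OF \<tau>] by simp
  have "complex_of_real ((cmod (fourier_L1 f \<xi>))\<^sup>2 * exp (- (2 * pi * \<tau> * \<xi>)\<^sup>2 / 2))
      = (LINT u|lborel. ?w \<xi> * ?R u * cis (- 2 * pi * u * \<xi>))" for \<xi>
  proof -
    have "complex_of_real ((cmod (fourier_L1 f \<xi>))\<^sup>2 * exp (- (2 * pi * \<tau> * \<xi>)\<^sup>2 / 2))
      = ?w \<xi> * fourier_L1 ?R \<xi>"
      by (simp add: fourier_autocorrelation[OF f])
    then show ?thesis
      by (simp add: fourier_L1_eq_lborel mult.assoc)
  qed
  then have "(LINT \<xi>|lborel. complex_of_real ((cmod (fourier_L1 f \<xi>))\<^sup>2 * exp (- (2 * pi * \<tau> * \<xi>)\<^sup>2 / 2)))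
     = (LINT \<xi>|lborel. (LINT u|lborel. ?w \<xi> * ?R u * cis (- 2 * pi * u * \<xi>)))"
    by simp
  also have "\<dots> = (LINT u|lborel. (LINT \<xi>|lborel. ?w \<xi> * ?R u * cis (- 2 * pi * u * \<xi>)))"
  proof (rule lborel_pair.Fubini_integral[symmetric])
    show "integrable (lborel \<Otimes>\<^sub>M lborel) (\<lambda>(\<xi>, u). ?w \<xi> * ?R u * cis (- 2 * pi * u * \<xi>))"
      by (rule Bochner_Integration.integrable_bound[OF integrable_pair_mult[OF w integrable_autocorrelation[OF f]]])
         (auto simp: norm_mult)
  qed
  also have "\<dots> = (LINT u|lborel. ?R u * complex_of_real (std_normal_density (u / \<tau>) / \<tau>))"
  proof (rule Bochner_Integration.integral_cong[OF refl])
    fix u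
    have "(LINT \<xi>|lborel. ?w \<xi> * ?R u * cis (- 2 * pi * u * \<xi>))
        = (LINT \<xi>|lborel. ?R u * (?w \<xi> * cis (- 2 * pi * u * \<xi>)))"
      by (simp only: mult_ac)
    also have "\<dots> = ?R u * complex_of_real (std_normal_density (u / \<tau>) / \<tau>)"
      unfolding integral_mult_right_zero fourier_gaussian[OF \<tau>] ..
    finally show "(LINT \<xi>|lborel. ?w \<xi> * ?R u * cis (- 2 * pi * u * \<xi>))
        = ?R u * complex_of_real (std_normal_density (u / \<tau>) / \<tau>)" .
  qed
  also have "\<dots> = \<bar>\<tau>\<bar> *\<^sub>R (LINT v|lborel. ?R (0 + \<tau> * v) * complex_of_real (std_normal_density ((0 + \<tau> * v) / \<tau>) / \<tau>))"
    using \<tau> by (intro lborel_integral_real_affine) simp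
  also have "\<dots> = (LINT v|lborel. \<tau> *\<^sub>R (?R (\<tau> * v) * complex_of_real (std_normal_density v / \<tau>)))"
    using \<tau> by simp
  also have "\<dots> = (LINT v|lborel. std_normal_density v * ?R (\<tau> * v))"
    using \<tau> by (intro Bochner_Integration.integral_cong) (auto simp: scaleR_conv_of_real)
  finally show ?thesis .
qed

section \<open>Plancherel\<close>

text \<open>The arithmetic-geometric mean inequality suffices here, since \<open>f\<close> and its
  translate have the same L2 norm. The bound is uniform in \<open>u\<close> and serves as a
  dominating function.\<close>

lemma cmod_autocorrelation_le:
  fixes f :: "real \<Rightarrow> complex"
  assumes [measurable]: "f \<in> borel_measurable borel" and f2: "integrable lborel (\<lambda>t. (cmod (f t))\<^sup>2)"
  shows "cmod (autocorrelation f u) \<le> (LINT t|lborel. (cmod (f t))\<^sup>2)"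
proof -
  note f2' = integrable_lborel_shift[OF f2, of u]
  have "cmod (f t * cnj (f (t - u))) \<le> ((cmod (f t))\<^sup>2 + (cmod (f (t - u)))\<^sup>2) / 2" for t
    using sum_squares_bound[of "cmod (f t)" "cmod (f (t - u))"] by (simp add: norm_mult)
  then have "cmod (autocorrelation f u) \<le> (LINT t|lborel. ((cmod (f t))\<^sup>2 + (cmod (f (t - u)))\<^sup>2) / 2)"
    unfolding autocorrelation_def
    by (intro order_trans[OF integral_norm_bound] integral_mono') (use f2 f2' in auto)
  also have "\<dots> = ((LINT t|lborel. (cmod (f t))\<^sup>2) + (LINT t|lborel. (cmod (f (t - u)))\<^sup>2)) / 2"
    using f2 f2' by simp
  also have "(LINT t|lborel. (cmod (f (t - u)))\<^sup>2) = (LINT t|lborel. (cmod (f t))\<^sup>2)"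
    by (rule integral_lborel_shift)
  finally show ?thesis by simp
qed

lemma autocorrelation_0: "autocorrelation f 0 = complex_of_real (LINT t|lborel. (cmod (f t))\<^sup>2)"
  unfolding autocorrelation_def by (simp add: complex_norm_square[symmetric] del: of_real_power)

text \<open>The difference of the integrands is \<open>f t * cnj (f (t - u) - f t)\<close>. Bounding
  the first factor by \<open>M\<close> reduces the claim to continuity of translation in L1.\<close>

lemma autocorrelation_tendsto:
  fixes f :: "real \<Rightarrow> complex"
  assumes f: "integrable lborel f" and M: "\<And>t. cmod (f t) \<le> M" and X: "X \<longlonglongrightarrow> 0"
  shows "(\<lambda>n. autocorrelation f (X n)) \<longlonglongrightarrow> autocorrelation f 0"
proof (rule LIM_zero_cancel, rule Lim_null_comparison)
  have [measurable]: "f \<in> borel_measurable borel"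
    using f by (simp add: borel_measurable_integrable)
  show "(\<lambda>n. M * (LINT t|lborel. norm (f (t - X n) - f t))) \<longlonglongrightarrow> 0"
    using tendsto_mult_right_zero[OF L1_translation_continuous[OF f X]] .
  have int: "integrable lborel (\<lambda>t. f t * cnj (f (t - u)))" for u
  proof (rule Bochner_Integration.integrable_bound)
    show "integrable lborel (\<lambda>t. M * f t)" using f by simp
    show "AE t in lborel. norm (f t * cnj (f (t - u))) \<le> norm (M * f t)"
      using M order_trans[OF norm_ge_zero M]
      by (auto simp: norm_mult mult.commute[of M] intro!: mult_left_mono)
  qed simp
  have "norm (autocorrelation f u - autocorrelation f 0) \<le> M * (LINT t|lborel. norm (f (t - u) - f t))" for u
  proof -
    have "autocorrelation f u - autocorrelation f 0 = (LINT t|lborel. f t * cnj (f (t - u)) - f t * cnj (f t))"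
      unfolding autocorrelation_def using int[of u] int[of 0] by simp
    also have "norm \<dots> \<le> (LINT t|lborel. M * norm (f (t - u) - f t))"
    proof (rule order_trans[OF integral_norm_bound], rule integral_mono')
      show "integrable lborel (\<lambda>t. M * norm (f (t - u) - f t))"
        using f integrable_lborel_shift[OF f, of u] by auto
      show "norm (f t * cnj (f (t - u)) - f t * cnj (f t)) \<le> M * norm (f (t - u) - f t)" for t
      proof -
        have "f t * cnj (f (t - u)) - f t * cnj (f t) = f t * cnj (f (t - u) - f t)"
          by (simp add: algebra_simps)
        then show ?thesis
          using M by (simp only: norm_mult complex_mod_cnj) (intro mult_right_mono, auto)
      qed
    qed (use order_trans[OF norm_ge_zero M] in simp)
    finally show ?thesis by simp
  qed
  then show "eventually (\<lambda>n. norm (autocorrelation f (X n) - autocorrelation f 0)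
      \<le> M * (LINT t|lborel. norm (f (t - X n) - f t))) sequentially"
    by simp
qed

section \<open>Plancherel for a fixed integrable and square-integrable function\<close>

context
  fixes f :: "real \<Rightarrow> complex"
  assumes f1: "integrable lborel f" and f2: "integrable lborel (\<lambda>t. (cmod (f t))\<^sup>2)"
begin

lemma borel_measurable_f [measurable]: "f \<in> borel_measurable borel"
  using f1 by (simp add: borel_measurable_integrable)

text \<open>Gaussian damping with \<open>\<tau> = 1 / Suc k\<close>. The transform is bounded, so
  the damped square is integrable before its undamped limit is known to be; \<open>Suc\<close>
  avoids a division by zero.\<close>

definition fourier_damped :: "nat \<Rightarrow> real \<Rightarrow> real" where
  "fourier_damped k \<xi> = (cmod (fourier_L1 f \<xi>))\<^sup>2 * exp (- (2 * pi * (1 / Suc k) * \<xi>)\<^sup>2 / 2)"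

lemma fourier_damped_nonneg: "0 \<le> fourier_damped k \<xi>"
  by (simp add: fourier_damped_def)

lemma fourier_damped_le: "fourier_damped k \<xi> \<le> (cmod (fourier_L1 f \<xi>))\<^sup>2"
  unfolding fourier_damped_def by (intro mult_left_le) auto

lemma borel_measurable_fourier_damped [measurable]: "fourier_damped k \<in> borel_measurable borel"
  unfolding fourier_damped_def[abs_def] by measurable

lemma integrable_fourier_damped: "integrable lborel (fourier_damped k)"
proof (rule Bochner_Integration.integrable_bound)
  show "integrable lborel (\<lambda>\<xi>. (LINT t|lebesgue. cmod (f t))\<^sup>2 * exp (- (2 * pi * (1 / Suc k) * \<xi>)\<^sup>2 / 2))"
    by (intro integrable_mult_right integrable_gaussian) simp
  show "AE \<xi> in lborel. norm (fourier_damped k \<xi>)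
      \<le> norm ((LINT t|lebesgue. cmod (f t))\<^sup>2 * exp (- (2 * pi * (1 / Suc k) * \<xi>)\<^sup>2 / 2))"
    unfolding fourier_damped_def
    by (auto simp: abs_mult intro!: mult_right_mono power_mono norm_fourier_L1_le)
qed simp

lemma fourier_damped_tendsto: "(\<lambda>k. fourier_damped k \<xi>) \<longlonglongrightarrow> (cmod (fourier_L1 f \<xi>))\<^sup>2"
proof -
  have "(\<lambda>k. exp (- (2 * pi * (1 / Suc k) * \<xi>)\<^sup>2 / 2)) \<longlonglongrightarrow> exp (- (2 * pi * 0 * \<xi>)\<^sup>2 / 2)"
    using LIMSEQ_inverse_real_of_nat by (intro tendsto_intros) (simp_all add: inverse_eq_divide)
  then show ?thesis
    unfolding fourier_damped_def using tendsto_mult[OF tendsto_const] by fastforce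
qed

lemma integral_fourier_damped:
  "complex_of_real (LINT \<xi>|lborel. fourier_damped k \<xi>)
     = (LINT v|lborel. std_normal_density v * autocorrelation f (1 / Suc k * v))"
  unfolding fourier_damped_def integral_complex_of_real[symmetric]
  by (rule fourier_gaussian_summation[OF f1]) simp

lemma integral_fourier_damped_le: "(LINT \<xi>|lborel. fourier_damped k \<xi>) \<le> (LINT t|lborel. (cmod (f t))\<^sup>2)"
proof -
  have "(LINT \<xi>|lborel. fourier_damped k \<xi>) \<le> cmod (LINT v|lborel. std_normal_density v * autocorrelation f (1 / Suc k * v))"
    unfolding integral_fourier_damped[symmetric] by simp
  also have "\<dots> \<le> (LINT v|lborel. std_normal_density v * (LINT t|lborel. (cmod (f t))\<^sup>2))"
    by (intro order_trans[OF integral_norm_bound] integral_mono')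
       (auto simp: norm_mult intro!: mult_left_mono cmod_autocorrelation_le f2)
  finally show ?thesis by simp
qed

text \<open>The damped integrals are averages of the autocorrelation and so never exceed the squared
  norm of \<open>f\<close>; Fatou's lemma passes this to the limit and yields integrability along
  with the inequality.\<close>

lemma fourier_L1_bessel:
  "integrable lborel (\<lambda>\<xi>. (cmod (fourier_L1 f \<xi>))\<^sup>2)" (is ?int)
  "(LINT \<xi>|lborel. (cmod (fourier_L1 f \<xi>))\<^sup>2) \<le> (LINT t|lborel. (cmod (f t))\<^sup>2)" (is ?le)
proof -
  have lim: "liminf (\<lambda>k. ennreal (fourier_damped k \<xi>)) = ennreal ((cmod (fourier_L1 f \<xi>))\<^sup>2)" for \<xi>
    using fourier_damped_tendsto by (intro lim_imp_Liminf tendsto_ennrealI) auto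
  have "(\<integral>\<^sup>+\<xi>. ennreal ((cmod (fourier_L1 f \<xi>))\<^sup>2) \<partial>lborel)
      \<le> liminf (\<lambda>k. \<integral>\<^sup>+\<xi>. ennreal (fourier_damped k \<xi>) \<partial>lborel)"
    using nn_integral_liminf[of "\<lambda>k \<xi>. ennreal (fourier_damped k \<xi>)" lborel] by (simp add: lim)
  also have "\<dots> \<le> ennreal (LINT t|lborel. (cmod (f t))\<^sup>2)"
    using integral_fourier_damped_le
    by (intro Liminf_le always_eventually allI)
       (auto simp: nn_integral_eq_integral[OF integrable_fourier_damped] fourier_damped_nonneg ennreal_leI)
  finally have le: "(\<integral>\<^sup>+\<xi>. ennreal ((cmod (fourier_L1 f \<xi>))\<^sup>2) \<partial>lborel) \<le> ennreal (LINT t|lborel. (cmod (f t))\<^sup>2)" .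
  show ?int
    using le by (intro integrableI_bounded) (auto simp: less_top[symmetric] top_unique)
  then show ?le
    using le by (simp add: nn_integral_eq_integral)
qed

text \<open>The damped integrals have two limits. On the frequency side the integrable
  \<open>(cmod (fourier_L1 f \<xi>))\<^sup>2\<close> dominates; on the time side the average of the
  autocorrelation tends to its value at 0, where the bound \<open>M\<close> supplies
  continuity.\<close>

lemma fourier_L1_plancherel:
  assumes M: "\<And>t. cmod (f t) \<le> M"
  shows "(LINT \<xi>|lborel. (cmod (fourier_L1 f \<xi>))\<^sup>2) = (LINT t|lborel. (cmod (f t))\<^sup>2)"
proof -
  have "(\<lambda>k. LINT \<xi>|lborel. fourier_damped k \<xi>) \<longlonglongrightarrow> (LINT \<xi>|lborel. (cmod (fourier_L1 f \<xi>))\<^sup>2)"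
  proof (rule integral_dominated_convergence[OF _ _ fourier_L1_bessel(1)])
    show "AE \<xi> in lborel. (\<lambda>k. fourier_damped k \<xi>) \<longlonglongrightarrow> (cmod (fourier_L1 f \<xi>))\<^sup>2"
      by (simp add: fourier_damped_tendsto)
    show "AE \<xi> in lborel. norm (fourier_damped k \<xi>) \<le> (cmod (fourier_L1 f \<xi>))\<^sup>2" for k
      by (simp add: fourier_damped_le fourier_damped_nonneg)
  qed simp_all
  then have 1: "(\<lambda>k. complex_of_real (LINT \<xi>|lborel. fourier_damped k \<xi>))
      \<longlonglongrightarrow> complex_of_real (LINT \<xi>|lborel. (cmod (fourier_L1 f \<xi>))\<^sup>2)"
    by (rule tendsto_of_real)
  have "(\<lambda>k. LINT v|lborel. std_normal_density v * autocorrelation f (1 / Suc k * v))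
      \<longlonglongrightarrow> (LINT v|lborel. std_normal_density v * autocorrelation f 0)"
  proof (rule integral_dominated_convergence)
    show "integrable lborel (\<lambda>v. std_normal_density v * (LINT t|lborel. (cmod (f t))\<^sup>2))"
      by simp
    show "AE v in lborel. norm (std_normal_density v * autocorrelation f (1 / Suc k * v))
        \<le> std_normal_density v * (LINT t|lborel. (cmod (f t))\<^sup>2)" for k
      by (auto simp: norm_mult intro!: mult_left_mono cmod_autocorrelation_le f2)
    have "(\<lambda>k. 1 / real (Suc k) * v) \<longlonglongrightarrow> 0" for v
      using tendsto_mult_left_zero[OF LIMSEQ_inverse_real_of_nat, of v] by (simp add: inverse_eq_divide)
    then show "AE v in lborel. (\<lambda>k. std_normal_density v * autocorrelation f (1 / Suc k * v))
        \<longlonglongrightarrow> std_normal_density v * autocorrelation f 0"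
      by (intro AE_I2 tendsto_mult tendsto_const autocorrelation_tendsto[OF f1 M])
  qed simp_all
  also have "(LINT v|lborel. std_normal_density v * autocorrelation f 0) = autocorrelation f 0"
    by simp
  finally have 2: "(\<lambda>k. complex_of_real (LINT \<xi>|lborel. fourier_damped k \<xi>))
      \<longlonglongrightarrow> complex_of_real (LINT t|lborel. (cmod (f t))\<^sup>2)"
    unfolding integral_fourier_damped autocorrelation_0 .
  show ?thesis
    using LIMSEQ_unique[OF 1 2] by (simp only: of_real_eq_iff)
qed

end

section \<open>The Fourier transform on square-integrable functions\<close>

text \<open>The arguments on product spaces use \<open>lborel\<close>, whereas \<open>L2\<close> and
  \<open>fourier_L1\<close> refer to its completion. A Borel function that agrees almost everywhere
  links the two; it is built from real and imaginary parts.\<close>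

lemma borel_representative:
  fixes f :: "real \<Rightarrow> complex"
  assumes [measurable]: "f \<in> borel_measurable lebesgue"
  obtains f' where "f' \<in> borel_measurable borel" "AE x in lebesgue. f x = f' x"
proof -
  have "(\<lambda>x. Re (f x)) \<in> borel_measurable lebesgue" "(\<lambda>x. Im (f x)) \<in> borel_measurable lebesgue"
    by measurable
  from this[THEN completion_ex_borel_measurable_real]
  obtain a b where ab [measurable]: "a \<in> borel_measurable lborel" "b \<in> borel_measurable lborel"
    and "AE x in lborel. Re (f x) = a x" "AE x in lborel. Im (f x) = b x"
    by auto
  then have "AE x in lborel. f x = Complex (a x) (b x)"
    by (auto simp: complex_eq_iff)
  then have "AE x in lebesgue. f x = Complex (a x) (b x)"
    by (rule AE_completion)
  moreover have "(\<lambda>x. Complex (a x) (b x)) \<in> borel_measurable borel"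
    unfolding Complex_eq using ab by measurable
  ultimately show thesis by (rule that[rotated])
qed

section \<open>Invariance under almost everywhere equality, and linearity of the transform\<close>

lemma L2_norm_cong_AE:
  assumes "f \<in> borel_measurable lebesgue" "g \<in> borel_measurable lebesgue"
    and "AE x in lebesgue. f x = g x"
  shows "L2_norm f = L2_norm g"
  unfolding L2_norm_def using assms
  by (intro arg_cong[where f = sqrt] integral_cong_AE) auto

lemma L2_cong_AE:
  assumes "f \<in> L2" "g \<in> borel_measurable lebesgue" and "AE x in lebesgue. f x = g x"
  shows "g \<in> L2"
  by (rule L2_bound[OF assms(2) L2_integrable[OF assms(1)]]) (use assms(3) in auto)

lemma fourier_L1_cong_AE:
  assumes [measurable]: "f \<in> borel_measurable lebesgue" "g \<in> borel_measurable lebesgue"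
    and "AE x in lebesgue. f x = g x"
  shows "fourier_L1 f = fourier_L1 g"
proof
  fix \<xi>
  have "(\<lambda>t. cis (- 2 * pi * t * \<xi>)) \<in> borel_measurable lebesgue"
    by (rule measurable_completion) simp
  then show "fourier_L1 f \<xi> = fourier_L1 g \<xi>"
    unfolding fourier_L1_eq_cis
    by (intro integral_cong_AE borel_measurable_times) (use assms(3) in auto)
qed

lemma integrable_lebesgue_cis_mult:
  assumes "integrable lebesgue f"
  shows "integrable lebesgue (\<lambda>t. f t * cis (- 2 * pi * t * \<xi>))"
  by (rule integrable_cis_mult[OF assms], rule measurable_completion) simp

lemma fourier_L1_diff:
  assumes "integrable lebesgue f" "integrable lebesgue g"
  shows "fourier_L1 (\<lambda>x. f x - g x) = (\<lambda>\<xi>. fourier_L1 f \<xi> - fourier_L1 g \<xi>)"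
  unfolding fourier_L1_eq_cis left_diff_distrib fun_eq_iff
  by (intro allI Bochner_Integration.integral_diff integrable_lebesgue_cis_mult assms)

lemma L1_L2_borel_representative:
  assumes f: "integrable lebesgue f" "f \<in> L2"
  obtains f' where "f' \<in> borel_measurable borel" "AE x in lebesgue. f x = f' x"
    "integrable lborel f'" "integrable lborel (\<lambda>x. (cmod (f' x))\<^sup>2)"
    "fourier_L1 f = fourier_L1 f'" "L2_norm f = sqrt (LINT x|lborel. (cmod (f' x))\<^sup>2)"
proof -
  note fm = L2_measurable[OF f(2)]
  obtain f' where f'[measurable]: "f' \<in> borel_measurable borel" and ae: "AE x in lebesgue. f x = f' x"
    using borel_representative[OF fm] by auto
  have m: "f' \<in> borel_measurable lebesgue" by (rule measurable_completion) simp
  have "integrable lebesgue f'"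
    by (rule integrable_cong_AE_imp[OF f(1) m]) (use ae in auto)
  then have 1: "integrable lborel f'" by (simp add: integrable_completion)
  have "integrable lebesgue (\<lambda>x. (cmod (f' x))\<^sup>2)"
    using L2_cong_AE[OF f(2) m ae] by (rule L2_integrable)
  then have 2: "integrable lborel (\<lambda>x. (cmod (f' x))\<^sup>2)" by (simp add: integrable_completion)
  have "L2_norm f = L2_norm f'" by (rule L2_norm_cong_AE[OF fm m ae])
  also have "\<dots> = sqrt (LINT x|lborel. (cmod (f' x))\<^sup>2)"
    unfolding L2_norm_def by (simp add: integral_completion)
  finally show thesis
    using that[OF f' ae 1 2 fourier_L1_cong_AE[OF fm m ae]] by simp
qed

lemma L2_norm_lborel:
  "f \<in> borel_measurable borel \<Longrightarrow> L2_norm f = sqrt (LINT x|lborel. (cmod (f x))\<^sup>2)"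
  unfolding L2_norm_def by (simp add: integral_completion)

lemma fourier_L1_in_L2:
  assumes f: "integrable lebesgue f" "f \<in> L2"
  shows "fourier_L1 f \<in> L2" and "L2_norm (fourier_L1 f) \<le> L2_norm f"
proof -
  obtain f' where [measurable]: "f' \<in> borel_measurable borel" and f': "integrable lborel f'"
      "integrable lborel (\<lambda>x. (cmod (f' x))\<^sup>2)"
    and eq: "fourier_L1 f = fourier_L1 f'" "L2_norm f = sqrt (LINT x|lborel. (cmod (f' x))\<^sup>2)"
    using L1_L2_borel_representative[OF f] by metis
  note F = fourier_L1_bessel[OF f']
  show "fourier_L1 f \<in> L2"
    unfolding L2_def eq using F(1)
    by (auto intro!: measurable_completion simp: integrable_completion)
  show "L2_norm (fourier_L1 f) \<le> L2_norm f"
    unfolding eq using F(2) by (simp add: L2_norm_lborel)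
qed

lemma L2_norm_fourier_L1:
  assumes f: "integrable lebesgue f" "f \<in> L2" and M: "AE x in lebesgue. cmod (f x) \<le> M"
  shows "L2_norm (fourier_L1 f) = L2_norm f"
proof -
  \<comment> \<open>Clipping at \<open>M'\<close> alters the representative only on a null set and
    makes the bound hold everywhere, as \<open>fourier_L1_plancherel\<close> requires. The maximum
    with 0 ensures that the replacement value 0 obeys the bound too.\<close>
  define M' where "M' = max M 0"
  note fm = L2_measurable[OF f(2)]
  obtain f' where [measurable]: "f' \<in> borel_measurable borel" and ae: "AE x in lebesgue. f x = f' x"
    using borel_representative[OF fm] by auto
  define f'' where "f'' x = (if cmod (f' x) \<le> M' then f' x else 0)" for x
  have [measurable]: "f'' \<in> borel_measurable borel" unfolding f''_def[abs_def] by measurable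
  have m: "f'' \<in> borel_measurable lebesgue" by (rule measurable_completion) simp
  have ae'': "AE x in lebesgue. f x = f'' x"
    using ae M by eventually_elim (auto simp: f''_def M'_def)
  have "integrable lebesgue f''"
    by (rule integrable_cong_AE_imp[OF f(1) m]) (use ae'' in auto)
  then have 1: "integrable lborel f''" by (simp add: integrable_completion)
  have "integrable lebesgue (\<lambda>x. (cmod (f'' x))\<^sup>2)"
    using L2_cong_AE[OF f(2) m ae''] by (rule L2_integrable)
  then have 2: "integrable lborel (\<lambda>x. (cmod (f'' x))\<^sup>2)" by (simp add: integrable_completion)
  have "cmod (f'' t) \<le> M'" for t by (simp add: f''_def M'_def)
  then have "L2_norm (fourier_L1 f'') = L2_norm f''"
    using fourier_L1_plancherel[OF 1 2, of M'] by (simp add: L2_norm_lborel)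
  then show ?thesis
    using fourier_L1_cong_AE[OF fm m ae''] L2_norm_cong_AE[OF fm m ae''] by simp
qed

text \<open>The transform contracts the L2 distance on integrable square-integrable functions; apply
  this to \<open>\<phi> k\<close> and \<open>h\<close> and let \<open>k\<close> grow. The estimate
  holds for every admissible \<open>g\<close>, hence for the one selected by
  \<open>fourier_L2\<close>, and compares it with an explicit integral.\<close>

lemma has_fourier_L2_dist_le:
  assumes fg: "has_fourier_L2 f g" and h: "integrable lebesgue h" "h \<in> L2"
  shows "L2_norm (\<lambda>\<xi>. g \<xi> - fourier_L1 h \<xi>) \<le> L2_norm (\<lambda>x. f x - h x)"
proof -
  obtain \<phi> where f: "f \<in> L2" and g: "g \<in> L2"
    and \<phi>: "\<And>k. integrable lebesgue (\<phi> k)" "\<And>k. \<phi> k \<in> L2" "\<And>k. fourier_L1 (\<phi> k) \<in> L2"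
    and lim: "(\<lambda>k. L2_norm (\<lambda>x. \<phi> k x - f x)) \<longlonglongrightarrow> 0"
      "(\<lambda>k. L2_norm (\<lambda>\<xi>. fourier_L1 (\<phi> k) \<xi> - g \<xi>)) \<longlonglongrightarrow> 0"
    using fg unfolding has_fourier_L2_def by blast
  have le: "L2_norm (\<lambda>\<xi>. g \<xi> - fourier_L1 h \<xi>)
      \<le> L2_norm (\<lambda>\<xi>. fourier_L1 (\<phi> k) \<xi> - g \<xi>) + (L2_norm (\<lambda>x. \<phi> k x - f x) + L2_norm (\<lambda>x. f x - h x))" for k
  proof -
    have "L2_norm (\<lambda>\<xi>. g \<xi> - fourier_L1 h \<xi>)
        \<le> L2_norm (\<lambda>\<xi>. g \<xi> - fourier_L1 (\<phi> k) \<xi>) + L2_norm (\<lambda>\<xi>. fourier_L1 (\<phi> k) \<xi> - fourier_L1 h \<xi>)"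
      by (rule L2_norm_triangle_diff[OF g \<phi>(3) fourier_L1_in_L2(1)[OF h]])
    also have "L2_norm (\<lambda>\<xi>. fourier_L1 (\<phi> k) \<xi> - fourier_L1 h \<xi>) \<le> L2_norm (\<lambda>x. \<phi> k x - h x)"
      using fourier_L1_in_L2(2)[OF Bochner_Integration.integrable_diff[OF \<phi>(1) h(1)] L2_diff[OF \<phi>(2) h(2)]]
      unfolding fourier_L1_diff[OF \<phi>(1) h(1)] .
    also have "\<dots> \<le> L2_norm (\<lambda>x. \<phi> k x - f x) + L2_norm (\<lambda>x. f x - h x)"
      by (rule L2_norm_triangle_diff[OF \<phi>(2) f h(2)])
    finally show ?thesis by (simp add: L2_norm_minus_commute[of g])
  qed
  have "(\<lambda>k. L2_norm (\<lambda>\<xi>. fourier_L1 (\<phi> k) \<xi> - g \<xi>)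
      + (L2_norm (\<lambda>x. \<phi> k x - f x) + L2_norm (\<lambda>x. f x - h x))) \<longlonglongrightarrow> L2_norm (\<lambda>x. f x - h x)"
    using tendsto_add[OF lim(2) tendsto_add[OF lim(1) tendsto_const]] by simp
  then show ?thesis
    by (rule LIMSEQ_le_const) (use le in blast)
qed

text \<open>The weights \<open>2 ^ k\<close> turn square summability of the increments \<open>d\<^sub>k\<close> into absolute summability,
  because \<open>d\<^sub>k \<le> 2 ^ k * d\<^sub>k\<^sup>2 + 2 ^ (-k)\<close>; the limit in norm then follows from Fatou's lemma.\<close>

lemma L2_rapidly_Cauchy_convergent:
  assumes G: "\<And>k. G k \<in> L2" and d: "\<And>k. L2_norm (\<lambda>x. G (Suc k) x - G k x) \<le> (1/2) ^ k"
  obtains g where "g \<in> L2" "(\<lambda>k. L2_norm (\<lambda>x. G k x - g x)) \<longlonglongrightarrow> 0"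
proof -
  note [measurable] = L2_measurable[OF G]
  have nn: "(\<integral>\<^sup>+x. ennreal ((cmod (f x))\<^sup>2) \<partial>lebesgue) = ennreal ((L2_norm f)\<^sup>2)" if "f \<in> L2" for f
    unfolding L2_norm_square using L2_integrable[OF that] by (rule nn_integral_eq_integral) simp
  have "(\<integral>\<^sup>+x. (\<Sum>k. ennreal (2 ^ k * (cmod (G (Suc k) x - G k x))\<^sup>2)) \<partial>lebesgue)
      = (\<Sum>k. \<integral>\<^sup>+x. ennreal (2 ^ k * (cmod (G (Suc k) x - G k x))\<^sup>2) \<partial>lebesgue)"
    by (rule nn_integral_suminf) measurable
  also have "\<dots> \<le> (\<Sum>k. ennreal ((1/2) ^ k))"
  proof (rule suminf_le)
    fix k
    have "(\<integral>\<^sup>+x. ennreal (2 ^ k * (cmod (G (Suc k) x - G k x))\<^sup>2) \<partial>lebesgue)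
        = ennreal (2 ^ k) * (\<integral>\<^sup>+x. ennreal ((cmod (G (Suc k) x - G k x))\<^sup>2) \<partial>lebesgue)"
      unfolding ennreal_mult'[OF zero_le_power[OF zero_le_numeral]] by (rule nn_integral_cmult) measurable
    also have "\<dots> = ennreal (2 ^ k * (L2_norm (\<lambda>x. G (Suc k) x - G k x))\<^sup>2)"
      by (simp add: nn[OF L2_diff[OF G G]] ennreal_mult)
    also have "\<dots> \<le> ennreal (2 ^ k * ((1/2) ^ k)\<^sup>2)"
      by (intro ennreal_leI mult_left_mono power_mono d L2_norm_nonneg) simp
    also have "2 ^ k * ((1/2) ^ k)\<^sup>2 = (1/2 :: real) ^ k"
      by (simp add: power2_eq_square field_simps)
    finally show "(\<integral>\<^sup>+x. ennreal (2 ^ k * (cmod (G (Suc k) x - G k x))\<^sup>2) \<partial>lebesgue) \<le> ennreal ((1/2) ^ k)" .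
  qed auto
  also have "\<dots> < \<infinity>"
    by (subst suminf_ennreal2) (auto intro!: summable_geometric)
  finally have "AE x in lebesgue. (\<Sum>k. ennreal (2 ^ k * (cmod (G (Suc k) x - G k x))\<^sup>2)) \<noteq> \<infinity>"
    by (intro nn_integral_PInf_AE) (auto simp del: suminf_eq_zero_iff)
  then have conv: "AE x in lebesgue. convergent (\<lambda>k. G k x)"
  proof eventually_elim
    fix x assume "(\<Sum>k. ennreal (2 ^ k * (cmod (G (Suc k) x - G k x))\<^sup>2)) \<noteq> \<infinity>"
    then have "summable (\<lambda>k. 2 ^ k * (cmod (G (Suc k) x - G k x))\<^sup>2)"
      by (intro summable_suminf_not_top) auto
    then have s: "summable (\<lambda>k. 2 ^ k * (cmod (G (Suc k) x - G k x))\<^sup>2 + (1/2) ^ k)"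
      by (intro summable_add summable_geometric) auto
    have "cmod (G (Suc k) x - G k x) \<le> 2 ^ k * (cmod (G (Suc k) x - G k x))\<^sup>2 + (1/2) ^ k" for k
    proof -
      define a q where "a = cmod (G (Suc k) x - G k x)" and "q = (2::real) ^ k"
      have "q > 0" "a \<ge> 0" by (simp_all add: q_def a_def)
      have "2 * (q * a) \<le> (q * a)\<^sup>2 + 1" "0 \<le> q * a"
        using sum_squares_bound[of "q * a" 1] \<open>q > 0\<close> \<open>a \<ge> 0\<close> by simp_all
      then have "a * q \<le> (q * a)\<^sup>2 + 1"
        unfolding mult.commute[of a q] by linarith
      then have "a \<le> q * a\<^sup>2 + 1 / q"
        using \<open>q > 0\<close> by (simp add: field_simps power2_eq_square)
      then show ?thesis by (simp add: a_def q_def power_one_over)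
    qed
    then have "summable (\<lambda>k. G (Suc k) x - G k x)"
      by (intro summable_comparison_test[OF _ s]) auto
    then have "convergent (\<lambda>n. G n x - G 0 x)"
      unfolding summable_iff_convergent sum_lessThan_telescope[of "\<lambda>k. G k x"] .
    from convergent_add[OF this convergent_const[of "G 0 x"]]
    show "convergent (\<lambda>k. G k x)" by simp
  qed
  \<comment> \<open>Where the sequence diverges, \<open>lim\<close> has an unspecified value; these
    points form a null set.\<close>
  define g where "g x = lim (\<lambda>k. G k x)" for x
  have [measurable]: "g \<in> borel_measurable lebesgue"
    unfolding g_def[abs_def] by measurable
  have lim: "AE x in lebesgue. (\<lambda>k. G k x) \<longlonglongrightarrow> g x"
    using conv unfolding g_def by eventually_elim (simp add: convergent_LIMSEQ_iff)
  \<comment> \<open>The subtracted term makes the induction close exactly: each increment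
    \<open>(1/2) ^ (k + n)\<close> is the difference of two consecutive values of
    \<open>2 * (1/2) ^ (k + n)\<close>.\<close>
  have dist: "L2_norm (\<lambda>x. G (k + n) x - G k x) \<le> 2 * (1/2) ^ k - 2 * (1/2) ^ (k + n)" for k n
  proof (induction n)
    case 0
    then show ?case by (simp add: L2_norm_def)
  next
    case (Suc n)
    have "L2_norm (\<lambda>x. G (k + Suc n) x - G k x)
        \<le> L2_norm (\<lambda>x. G (Suc (k + n)) x - G (k + n) x) + L2_norm (\<lambda>x. G (k + n) x - G k x)"
      using L2_norm_triangle_diff[of "G (Suc (k + n))" "G (k + n)" "G k", OF G G G] by simp
    with d[of "k + n"] Suc show ?case by simp
  qed
  have *: "(\<lambda>x. G k x - g x) \<in> L2 \<and> L2_norm (\<lambda>x. G k x - g x) \<le> 2 * (1/2) ^ k" for k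
  proof -
    have "(\<integral>\<^sup>+x. ennreal ((cmod (G k x - g x))\<^sup>2) \<partial>lebesgue)
        = (\<integral>\<^sup>+x. liminf (\<lambda>n. ennreal ((cmod (G (k + n) x - G k x))\<^sup>2)) \<partial>lebesgue)"
    proof (rule nn_integral_cong_AE, use lim in eventually_elim)
      fix x assume "(\<lambda>k. G k x) \<longlonglongrightarrow> g x"
      then have "(\<lambda>n. G (k + n) x) \<longlonglongrightarrow> g x"
        using LIMSEQ_ignore_initial_segment[of "\<lambda>k. G k x" "g x" k] by (simp add: add.commute)
      then have "(\<lambda>n. ennreal ((cmod (G (k + n) x - G k x))\<^sup>2)) \<longlonglongrightarrow> ennreal ((cmod (g x - G k x))\<^sup>2)"
        by (intro tendsto_intros)
      then show "ennreal ((cmod (G k x - g x))\<^sup>2) = liminf (\<lambda>n. ennreal ((cmod (G (k + n) x - G k x))\<^sup>2))"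
        unfolding norm_minus_commute[of "G k x" "g x"] by (intro lim_imp_Liminf[symmetric]) simp_all
    qed
    also have "\<dots> \<le> liminf (\<lambda>n. \<integral>\<^sup>+x. ennreal ((cmod (G (k + n) x - G k x))\<^sup>2) \<partial>lebesgue)"
      by (rule nn_integral_liminf) measurable
    also have "\<dots> \<le> ennreal ((2 * (1/2) ^ k)\<^sup>2)"
    proof (intro Liminf_le always_eventually allI)
      fix n
      have "L2_norm (\<lambda>x. G (k + n) x - G k x) \<le> 2 * (1/2) ^ k"
        by (rule order_trans[OF dist]) simp
      then show "(\<integral>\<^sup>+x. ennreal ((cmod (G (k + n) x - G k x))\<^sup>2) \<partial>lebesgue) \<le> ennreal ((2 * (1/2) ^ k)\<^sup>2)"
        unfolding nn[OF L2_diff[OF G G]] by (intro ennreal_leI power_mono L2_norm_nonneg)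
    qed simp
    finally have le: "(\<integral>\<^sup>+x. ennreal ((cmod (G k x - g x))\<^sup>2) \<partial>lebesgue) \<le> ennreal ((2 * (1/2) ^ k)\<^sup>2)" .
    then have "integrable lebesgue (\<lambda>x. (cmod (G k x - g x))\<^sup>2)"
      by (intro integrableI_bounded) (auto simp: less_top[symmetric] top_unique)
    then have L2: "(\<lambda>x. G k x - g x) \<in> L2" by (simp add: L2_def)
    with le have "(L2_norm (\<lambda>x. G k x - g x))\<^sup>2 \<le> (2 * (1/2) ^ k)\<^sup>2"
      by (simp add: nn)
    then have "L2_norm (\<lambda>x. G k x - g x) \<le> 2 * (1/2) ^ k"
      by (rule power2_le_imp_le) simp
    with L2 show ?thesis by simp
  qed
  have "(\<lambda>k. 2 * (1/2 :: real) ^ k) \<longlonglongrightarrow> 0"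
    by (intro tendsto_mult_right_zero LIMSEQ_power_zero) simp
  then have "(\<lambda>k. L2_norm (\<lambda>x. G k x - g x)) \<longlonglongrightarrow> 0"
    by (rule tendsto_sandwich[OF _ _ tendsto_const, rotated 2]) (use * L2_norm_nonneg in auto)
  \<comment> \<open>Here \<open>g\<close> is recovered as \<open>G 0\<close> minus the difference
    \<open>G 0 - g\<close>.\<close>
  moreover have "g \<in> L2"
    using L2_diff[OF G[of 0] conjunct1[OF *[of 0]]] by simp
  ultimately show thesis by (rule that[rotated])
qed

section \<open>Truncation to bounded intervals and existence of the transform\<close>

lemma integrable_indicator_L2:
  assumes "f \<in> L2"
  shows "integrable lebesgue (\<lambda>x. indicator {a..b} x * f x)"
proof (rule Bochner_Integration.integrable_bound)
  show "integrable lebesgue (\<lambda>x. indicat_real {a..b} x + (cmod (f x))\<^sup>2)"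
    using L2_integrable[OF assms] by (intro Bochner_Integration.integrable_add) (auto simp: integrable_indicator_iff emeasure_lborel_Icc_eq)
  show "(\<lambda>x. indicator {a..b} x * f x) \<in> borel_measurable lebesgue"
    using L2_measurable[OF L2_indicator[OF assms, of "{a..b}"]] by simp
  \<comment> \<open>On the interval the modulus is bounded by \<open>1\<close> plus its square, and
    both are integrable there.\<close>
  have "c \<le> 1 + c\<^sup>2" if "0 \<le> c" for c :: real
    using sum_squares_bound[of c 1] that by (simp add: power2_eq_square)
  then show "AE x in lebesgue. norm (indicator {a..b} x * f x) \<le> norm (indicat_real {a..b} x + (cmod (f x))\<^sup>2)"
    by (auto simp: indicator_def)
qed

lemma L2_truncation_tendsto:
  assumes f: "f \<in> L2"
  shows "(\<lambda>k. L2_norm (\<lambda>x. indicator {- real k..real k} x * f x - f x)) \<longlonglongrightarrow> 0"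
proof -
  note [measurable] = L2_measurable[OF f]
  have "(\<lambda>k. LINT x|lebesgue. (cmod (indicator {- real k..real k} x * f x - f x))\<^sup>2)
      \<longlonglongrightarrow> (LINT x::real|lebesgue. 0)"
  proof (rule integral_dominated_convergence[OF _ _ L2_integrable[OF f]])
    have "(\<lambda>k. (cmod (indicator {- real k..real k} x * f x - f x))\<^sup>2) \<longlonglongrightarrow> 0" for x
    proof (rule tendsto_eventually)
      obtain n :: nat where n: "\<bar>x\<bar> \<le> real n" using real_arch_simple by blast
      show "eventually (\<lambda>k. (cmod (indicator {- real k..real k} x * f x - f x))\<^sup>2 = 0) sequentially"
        using eventually_ge_at_top[of n]
        by eventually_elim (use n in \<open>auto simp: indicator_def\<close>)
    qed
    then show "AE x in lebesgue. (\<lambda>k. (cmod (indicator {- real k..real k} x * f x - f x))\<^sup>2) \<longlonglongrightarrow> 0"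
      by simp
    show "(\<lambda>x. (cmod (indicator {- real k..real k} x * f x - f x))\<^sup>2) \<in> borel_measurable lebesgue" for k
      by (intro borel_measurable_integrable L2_integrable L2_diff L2_indicator f) simp
  qed (auto simp: indicator_def)
  from tendsto_real_sqrt[OF this] show ?thesis
    unfolding L2_norm_def by simp
qed

text \<open>Truncations of \<open>f\<close> are integrable and converge to \<open>f\<close> in L2.
  Along a fast subsequence the contraction property makes their transforms rapidly Cauchy, and
  completeness provides the limit.\<close>

lemma has_fourier_L2_exists:
  assumes f: "f \<in> L2"
  shows "\<exists>g. has_fourier_L2 f g"
proof -
  define \<psi> where "\<psi> k x = indicator {- real k..real k} x * f x" for k x
  have \<psi>: "integrable lebesgue (\<psi> k)" "\<psi> k \<in> L2" for k
    unfolding \<psi>_def[abs_def] using integrable_indicator_L2[OF f] L2_indicator[OF f] by auto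
  \<comment> \<open>The extra factor 1/2 in the rate keeps the sum of two consecutive errors below
    \<open>(1/2) ^ j\<close>.\<close>
  have "\<exists>k. L2_norm (\<lambda>x. \<psi> k x - f x) < (1/2) ^ j / 2" for j
  proof -
    have "eventually (\<lambda>k. L2_norm (\<lambda>x. \<psi> k x - f x) < (1/2) ^ j / 2) sequentially"
      unfolding \<psi>_def by (rule order_tendstoD(2)[OF L2_truncation_tendsto[OF f]]) simp
    then show ?thesis by (auto simp: eventually_sequentially)
  qed
  then obtain r where r: "\<And>j. L2_norm (\<lambda>x. \<psi> (r j) x - f x) < (1/2) ^ j / 2" by metis
  define \<phi> where "\<phi> j = \<psi> (r j)" for j
  have \<phi>: "integrable lebesgue (\<phi> j)" "\<phi> j \<in> L2" "fourier_L1 (\<phi> j) \<in> L2" for j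
    unfolding \<phi>_def using \<psi> fourier_L1_in_L2 by auto
  have d: "L2_norm (\<lambda>\<xi>. fourier_L1 (\<phi> (Suc j)) \<xi> - fourier_L1 (\<phi> j) \<xi>) \<le> (1/2) ^ j" for j
  proof -
    have "L2_norm (\<lambda>\<xi>. fourier_L1 (\<phi> (Suc j)) \<xi> - fourier_L1 (\<phi> j) \<xi>) \<le> L2_norm (\<lambda>x. \<phi> (Suc j) x - \<phi> j x)"
      using fourier_L1_in_L2(2)[OF Bochner_Integration.integrable_diff[OF \<phi>(1) \<phi>(1)] L2_diff[OF \<phi>(2) \<phi>(2)]]
      unfolding fourier_L1_diff[OF \<phi>(1) \<phi>(1)] .
    also have "\<dots> \<le> L2_norm (\<lambda>x. \<phi> (Suc j) x - f x) + L2_norm (\<lambda>x. f x - \<phi> j x)"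
      by (rule L2_norm_triangle_diff[OF \<phi>(2) f \<phi>(2)])
    also have "\<dots> \<le> (1/2) ^ Suc j / 2 + (1/2) ^ j / 2"
      using r[of j] r[of "Suc j"] L2_norm_minus_commute[of f "\<phi> j"] by (simp add: \<phi>_def)
    also have "\<dots> \<le> (1/2) ^ j" by simp
    finally show ?thesis .
  qed
  obtain g where g: "g \<in> L2" "(\<lambda>k. L2_norm (\<lambda>\<xi>. fourier_L1 (\<phi> k) \<xi> - g \<xi>)) \<longlonglongrightarrow> 0"
    using L2_rapidly_Cauchy_convergent[of "\<lambda>j. fourier_L1 (\<phi> j)", OF \<phi>(3) d] by metis
  have "(\<lambda>j. (1/2 :: real) ^ j / 2) \<longlonglongrightarrow> 0"
    using tendsto_divide_zero[OF LIMSEQ_power_zero[of "1/2 :: real"], of 2] by simp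
  then have "(\<lambda>j. L2_norm (\<lambda>x. \<phi> j x - f x)) \<longlonglongrightarrow> 0"
    by (rule tendsto_sandwich[OF _ _ tendsto_const, rotated 2])
       (use r L2_norm_nonneg in \<open>auto simp: \<phi>_def less_imp_le\<close>)
  with f g \<phi> show ?thesis unfolding has_fourier_L2_def by blast
qed

lemma has_fourier_L2_fourier_L2: "f \<in> L2 \<Longrightarrow> has_fourier_L2 f (fourier_L2 f)"
  unfolding fourier_L2_def by (rule someI_ex[OF has_fourier_L2_exists])

section \<open>Time-frequency concentration\<close>

text \<open>Up to conjugation, the transform of a truncated function at one frequency is the
  coefficient of a truncated exponential against \<open>f\<close>. Bessel's inequality therefore
  applies frequency by frequency.\<close>

lemma cmod_fourier_L1_truncated:
  "cmod (fourier_L1 (\<lambda>t. indicator A t * f t) \<xi>)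
     = cmod (L2_inner (\<lambda>t. indicator A t * cis (2 * pi * t * \<xi>)) f)"
proof -
  have "L2_inner (\<lambda>t. indicator A t * cis (2 * pi * t * \<xi>)) f
     = (LINT t|lebesgue. cnj (indicator A t * f t * cis (- 2 * pi * t * \<xi>)))"
    unfolding L2_inner_def
    by (rule Bochner_Integration.integral_cong) (auto simp: indicator_def cis_cnj)
  also have "\<dots> = cnj (fourier_L1 (\<lambda>t. indicator A t * f t) \<xi>)"
    unfolding fourier_L1_eq_cis by (simp del: complex_cnj_mult)
  finally show ?thesis by simp
qed

lemma sum_fourier_L1_truncated_le:
  assumes "finite I" "L2_orthonormal I e" "0 \<le> T"
  shows "(\<Sum>i\<in>I. (cmod (fourier_L1 (\<lambda>t. indicator {- T..T} t * e i t) \<xi>))\<^sup>2) \<le> 2 * T"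
proof -
  let ?h = "\<lambda>t. indicator {- T..T} t * cis (2 * pi * t * \<xi>)"
  have h: "(cmod (?h t))\<^sup>2 = indicat_real {- T..T} t" for t
    by (simp add: indicator_def)
  have "?h \<in> borel_measurable borel" by measurable
  then have "?h \<in> borel_measurable lebesgue" by (intro measurable_completion) simp
  then have "?h \<in> L2"
    unfolding L2_def mem_Collect_eq h by (simp add: integrable_indicator_iff emeasure_lborel_Icc_eq)
  from L2_bessel[OF assms(1,2) this] show ?thesis
    unfolding h cmod_fourier_L1_truncated using assms(3) by simp
qed

lemma L2_split:
  assumes "f \<in> L2" and A: "A \<in> sets lebesgue"
  shows "(LINT x|lebesgue. (cmod (f x))\<^sup>2)
       = (LINT x|lebesgue. indicator A x * (cmod (f x))\<^sup>2) + (LINT x|lebesgue. indicator (- A) x * (cmod (f x))\<^sup>2)"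
proof -
  have int: "integrable lebesgue (\<lambda>x. indicator B x * (cmod (f x))\<^sup>2)" if "B \<in> sets lebesgue" for B
    using integrable_mult_indicator[OF that L2_integrable[OF assms(1)]] by simp
  have "- A \<in> sets lebesgue"
    using sets.compl_sets[OF A] by (simp add: Compl_eq_Diff_UNIV)
  note int = int[OF A] int[OF this]
  have "(LINT x|lebesgue. (cmod (f x))\<^sup>2)
      = (LINT x|lebesgue. indicator A x * (cmod (f x))\<^sup>2 + indicator (- A) x * (cmod (f x))\<^sup>2)"
    by (rule Bochner_Integration.integral_cong) (auto simp: indicator_def)
  also have "\<dots> = (LINT x|lebesgue. indicator A x * (cmod (f x))\<^sup>2)
      + (LINT x|lebesgue. indicator (- A) x * (cmod (f x))\<^sup>2)"
    by (rule Bochner_Integration.integral_add[OF int])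
  finally show ?thesis .
qed

text \<open>The energy that the truncated functions \<open>P i\<close> carry in the band from
  \<open>-W\<close> to \<open>W\<close> is summed over \<open>i\<close> and estimated twice: each
  member contributes at least \<open>1 - 5 * \<eta>\<close>, while the total is at most
  \<open>2 * T\<close> integrated over a band of length \<open>2 * W\<close>.\<close>

lemma card_orthonormal_concentrated_le:
  fixes T W \<eta> M :: real
  assumes fin: "finite I" and orth: "L2_orthonormal I e"
    and M: "\<And>i. i \<in> I \<Longrightarrow> AE x in lebesgue. cmod (e i x) \<le> M"
    and F: "\<And>i. i \<in> I \<Longrightarrow> has_fourier_L2 (e i) (g i)"
    and TW: "0 \<le> T" "0 \<le> W"
    and time: "\<And>i. i \<in> I \<Longrightarrow> (LINT x|lebesgue. indicator (- {- T..T}) x * (cmod (e i x))\<^sup>2) \<le> \<eta>"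
    and freq: "\<And>i. i \<in> I \<Longrightarrow> (LINT \<xi>|lebesgue. indicator (- {- W..W}) \<xi> * (cmod (g i \<xi>))\<^sup>2) \<le> \<eta>"
  shows "real (card I) * (1 - 5 * \<eta>) \<le> 4 * T * W"
proof -
  define P where "P i t = indicator {- T..T} t * e i t" for i t
  have e: "e i \<in> L2" if "i \<in> I" for i
    using orth that by (simp add: L2_orthonormal_def)
  have g: "g i \<in> L2" if "i \<in> I" for i
    using F[OF that] by (simp add: has_fourier_L2_def)
  have P: "integrable lebesgue (P i)" "P i \<in> L2" if "i \<in> I" for i
    unfolding P_def[abs_def] using integrable_indicator_L2 L2_indicator e[OF that] by auto
  have FP: "fourier_L1 (P i) \<in> L2" if "i \<in> I" for i
    by (rule fourier_L1_in_L2(1)[OF P[OF that]])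
  have int: "integrable lebesgue (\<lambda>x. indicator A x * (cmod (f x))\<^sup>2)"
    if "f \<in> L2" "A \<in> sets lebesgue" for f A
    using integrable_mult_indicator[OF that(2) L2_integrable[OF that(1)]] by simp
  \<comment> \<open>One \<open>\<eta>\<close> is lost by truncating in time. Out of band, the
    inequality with factor 2 costs \<open>2 * \<eta>\<close> for the tail of \<open>g i\<close> and
    \<open>2 * \<eta>\<close> for its distance from the transform of \<open>P i\<close>.\<close>
  have lower: "1 - 5 * \<eta> \<le> (LINT \<xi>|lebesgue. indicator {- W..W} \<xi> * (cmod (fourier_L1 (P i) \<xi>))\<^sup>2)"
    if i: "i \<in> I" for i
  proof -
    let ?D = "\<lambda>\<xi>. g i \<xi> - fourier_L1 (P i) \<xi>"
    note D = L2_diff[OF g[OF i] FP[OF i]]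
    have "complex_of_real (LINT x|lebesgue. (cmod (e i x))\<^sup>2) = L2_inner (e i) (e i)"
      unfolding L2_inner_def complex_norm_square[symmetric] by (simp del: of_real_power)
    also have "\<dots> = 1" using orth i by (simp add: L2_orthonormal_def)
    finally have "1 = (LINT x|lebesgue. (cmod (e i x))\<^sup>2)"
      by (metis of_real_1 of_real_eq_iff)
    also have "\<dots> = (LINT x|lebesgue. indicator {- T..T} x * (cmod (e i x))\<^sup>2)
        + (LINT x|lebesgue. indicator (- {- T..T}) x * (cmod (e i x))\<^sup>2)"
      by (rule L2_split[OF e[OF i]]) simp
    also have "(LINT x|lebesgue. indicator {- T..T} x * (cmod (e i x))\<^sup>2) = (L2_norm (P i))\<^sup>2"
      unfolding L2_norm_square P_def
      by (rule Bochner_Integration.integral_cong) (auto simp: indicator_def)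
    finally have "1 - \<eta> \<le> (L2_norm (P i))\<^sup>2" using time[OF i] by simp
    \<comment> \<open>A lower bound on the transform is wanted, so the contraction inequality would
      not do; the essential bound \<open>M\<close> gives the Plancherel equality.\<close>
    also have "\<dots> = (L2_norm (fourier_L1 (P i)))\<^sup>2"
    proof -
      have "AE x in lebesgue. cmod (P i x) \<le> max M 0"
        using M[OF i] by eventually_elim (auto simp: P_def indicator_def)
      then show ?thesis by (simp add: L2_norm_fourier_L1[OF P[OF i]])
    qed
    also have "\<dots> = (LINT \<xi>|lebesgue. indicator {- W..W} \<xi> * (cmod (fourier_L1 (P i) \<xi>))\<^sup>2)
        + (LINT \<xi>|lebesgue. indicator (- {- W..W}) \<xi> * (cmod (fourier_L1 (P i) \<xi>))\<^sup>2)"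
      unfolding L2_norm_square by (rule L2_split[OF FP[OF i]]) simp
    also have "(LINT \<xi>|lebesgue. indicator (- {- W..W}) \<xi> * (cmod (fourier_L1 (P i) \<xi>))\<^sup>2)
        \<le> (LINT \<xi>|lebesgue. 2 * (indicator (- {- W..W}) \<xi> * (cmod (g i \<xi>))\<^sup>2) + 2 * (cmod (?D \<xi>))\<^sup>2)"
    proof (rule integral_mono)
      show "integrable lebesgue (\<lambda>\<xi>. indicator (- {- W..W}) \<xi> * (cmod (fourier_L1 (P i) \<xi>))\<^sup>2)"
        by (rule int[OF FP[OF i]]) simp
      show "integrable lebesgue (\<lambda>\<xi>. 2 * (indicator (- {- W..W}) \<xi> * (cmod (g i \<xi>))\<^sup>2) + 2 * (cmod (?D \<xi>))\<^sup>2)"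
        using int[OF g[OF i], of "- {- W..W}"] L2_integrable[OF D] by simp
      show "indicator (- {- W..W}) \<xi> * (cmod (fourier_L1 (P i) \<xi>))\<^sup>2
          \<le> 2 * (indicator (- {- W..W}) \<xi> * (cmod (g i \<xi>))\<^sup>2) + 2 * (cmod (?D \<xi>))\<^sup>2" for \<xi>
        using cmod_add_square_le[of 1 "g i \<xi>" "- ?D \<xi>"]
        unfolding norm_minus_cancel by (auto simp: indicator_def)
    qed
    also have "\<dots> = 2 * (LINT \<xi>|lebesgue. indicator (- {- W..W}) \<xi> * (cmod (g i \<xi>))\<^sup>2) + 2 * (L2_norm ?D)\<^sup>2"
      using int[OF g[OF i], of "- {- W..W}"] L2_integrable[OF D] unfolding L2_norm_square by simp
    \<comment> \<open>The distance on the frequency side is controlled by that between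
      \<open>e i\<close> and its truncation, which is again the time tail.\<close>
    also have "(L2_norm ?D)\<^sup>2 \<le> (L2_norm (\<lambda>x. e i x - P i x))\<^sup>2"
      by (intro power_mono has_fourier_L2_dist_le[OF F[OF i] P[OF i]] L2_norm_nonneg)
    also have "(L2_norm (\<lambda>x. e i x - P i x))\<^sup>2 = (LINT x|lebesgue. indicator (- {- T..T}) x * (cmod (e i x))\<^sup>2)"
      unfolding L2_norm_square P_def
      by (rule Bochner_Integration.integral_cong) (auto simp: indicator_def)
    finally show ?thesis using time[OF i] freq[OF i] by simp
  qed
  have "real (card I) * (1 - 5 * \<eta>)
      \<le> (\<Sum>i\<in>I. LINT \<xi>|lebesgue. indicator {- W..W} \<xi> * (cmod (fourier_L1 (P i) \<xi>))\<^sup>2)"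
    using sum_bounded_below[of I "1 - 5 * \<eta>"] lower by simp
  also have "\<dots> = (LINT \<xi>|lebesgue. (\<Sum>i\<in>I. indicator {- W..W} \<xi> * (cmod (fourier_L1 (P i) \<xi>))\<^sup>2))"
    by (rule Bochner_Integration.integral_sum[symmetric]) (auto intro: int FP)
  also have "\<dots> \<le> (LINT \<xi>|lebesgue. indicat_real {- W..W} \<xi> * (2 * T))"
  proof (rule integral_mono)
    show "integrable lebesgue (\<lambda>\<xi>. \<Sum>i\<in>I. indicator {- W..W} \<xi> * (cmod (fourier_L1 (P i) \<xi>))\<^sup>2)"
      by (intro Bochner_Integration.integrable_sum int FP) simp_all
    show "integrable lebesgue (\<lambda>\<xi>. indicat_real {- W..W} \<xi> * (2 * T))"
      by (intro integrable_mult_left) (simp add: integrable_indicator_iff emeasure_lborel_Icc_eq)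
    show "(\<Sum>i\<in>I. indicator {- W..W} \<xi> * (cmod (fourier_L1 (P i) \<xi>))\<^sup>2) \<le> indicat_real {- W..W} \<xi> * (2 * T)" for \<xi>
      unfolding sum_distrib_left[symmetric] P_def
      by (intro mult_left_mono sum_fourier_L1_truncated_le fin orth TW) simp
  qed
  also have "\<dots> = 4 * T * W"
    using TW by simp
  finally show ?thesis .
qed

section \<open>Decay and the resulting bounds\<close>

text \<open>The antiderivative \<open>?F\<close> vanishes at infinity because the exponent
  \<open>1 - 2 * p\<close> is negative.\<close>

lemma nn_integral_powr_tail:
  fixes p T :: real
  assumes p: "1/2 < p" and T: "0 \<le> T"
  shows "(\<integral>\<^sup>+x. ennreal ((1 + x) powr (- 2 * p)) * indicator {T..} x \<partial>lborel)
       = ennreal ((1 + T) powr (1 - 2 * p) / (2 * p - 1))"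
proof -
  let ?F = "\<lambda>x::real. - ((1 + x) powr (1 - 2 * p) / (2 * p - 1))"
  have "(\<integral>\<^sup>+x. ennreal ((1 + x) powr (- 2 * p)) * indicator {T..} x \<partial>lborel) = ennreal (0 - ?F T)"
  proof (rule nn_integral_FTC_atLeast)
    show "DERIV ?F x :> (1 + x) powr (- 2 * p)" if "T \<le> x" for x
    proof -
      have "((\<lambda>x. (1 + x) powr (1 - 2 * p)) has_real_derivative (1 - 2 * p) * (1 + x) powr (1 - 2 * p - 1)) (at x)"
        using that T by (auto intro!: derivative_eq_intros)
      from DERIV_minus[OF DERIV_cdivide[OF this, of "2 * p - 1"]]
      have "DERIV ?F x :> - ((1 - 2 * p) / (2 * p - 1)) * (1 + x) powr (- 2 * p)"
        by simp
      moreover have "- ((1 - 2 * p) / (2 * p - 1)) = 1"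
        using p by (simp add: divide_simps)
      ultimately show ?thesis by (simp only: mult_1)
    qed
    have "((\<lambda>x::real. (1 + x) powr (1 - 2 * p)) \<longlongrightarrow> 0) at_top"
      using p by (intro tendsto_neg_powr filterlim_tendsto_add_at_top[OF tendsto_const] filterlim_ident) simp
    from tendsto_minus[OF tendsto_divide_zero[OF this, of "2 * p - 1"]]
    show "(?F \<longlongrightarrow> 0) at_top" by simp
  qed auto
  then show ?thesis by simp
qed

lemma integral_tail_le:
  fixes f :: "real \<Rightarrow> complex" and C p T :: real
  assumes p: "1/2 < p" and T: "0 \<le> T"
    and f: "AE x in lebesgue. cmod (f x) \<le> C / (1 + \<bar>x\<bar>) powr p"
  shows "(LINT x|lebesgue. indicator (- {- T..T}) x * (cmod (f x))\<^sup>2)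
     \<le> 2 * C\<^sup>2 / (2 * p - 1) * (1 + T) powr (1 - 2 * p)"
proof (rule integral_real_bounded)
  let ?t = "\<lambda>x::real. ennreal ((1 + x) powr (- 2 * p)) * indicator {T..} x"
  \<comment> \<open>The estimate goes through the nonnegative integral. Nonnegativity of the bound
    covers the default value 0 of a non-integrable integrand.\<close>
  show "0 \<le> 2 * C\<^sup>2 / (2 * p - 1) * (1 + T) powr (1 - 2 * p)"
    using p by simp
  \<comment> \<open>The complement of the interval lies in two half-lines, the left one being the
    reflection of the right one. The argument \<open>0 + (-1) * x\<close> has the shape of the
    affine change of variable used afterwards.\<close>
  have "(\<integral>\<^sup>+x. ennreal (indicator (- {- T..T}) x * (cmod (f x))\<^sup>2) \<partial>lebesgue)
      \<le> (\<integral>\<^sup>+x. ennreal (C\<^sup>2) * (?t x + ?t (0 + (-1) * x)) \<partial>lebesgue)"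
  proof (rule nn_integral_mono_AE, use f in eventually_elim)
    fix x :: real assume "cmod (f x) \<le> C / (1 + \<bar>x\<bar>) powr p"
    then have "(cmod (f x))\<^sup>2 \<le> (C / (1 + \<bar>x\<bar>) powr p)\<^sup>2"
      by (rule power_mono) simp
    also have "\<dots> = C\<^sup>2 * (1 + \<bar>x\<bar>) powr (- 2 * p)"
    proof -
      have "((1 + \<bar>x\<bar>) powr p)\<^sup>2 = (1 + \<bar>x\<bar>) powr (2 * p)"
        by (simp add: power2_eq_square flip: powr_add)
      then show ?thesis
        by (simp add: power_divide powr_minus_divide)
    qed
    finally have le: "(cmod (f x))\<^sup>2 \<le> C\<^sup>2 * (1 + \<bar>x\<bar>) powr (- 2 * p)" .
    consider "x \<in> {- T..T}" | "x > T" | "x < - T" by fastforce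
    then show "ennreal (indicator (- {- T..T}) x * (cmod (f x))\<^sup>2) \<le> ennreal (C\<^sup>2) * (?t x + ?t (0 + (-1) * x))"
    proof cases
      case 2
      then show ?thesis
        using le T by (auto simp: ennreal_mult[symmetric] intro!: ennreal_leI)
    next
      case 3
      then show ?thesis
        using le T by (auto simp: ennreal_mult[symmetric] intro!: ennreal_leI)
    qed simp
  qed
  also have "\<dots> = (\<integral>\<^sup>+x. ennreal (C\<^sup>2) * (?t x + ?t (0 + (-1) * x)) \<partial>lborel)"
    by (rule nn_integral_completion)
  also have "\<dots> = ennreal (C\<^sup>2) * ((\<integral>\<^sup>+x. ?t x \<partial>lborel) + (\<integral>\<^sup>+x. ?t (0 + (-1) * x) \<partial>lborel))"
    by (subst nn_integral_cmult) (auto simp: nn_integral_add)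
  also have "(\<integral>\<^sup>+x. ?t (0 + (-1) * x) \<partial>lborel) = (\<integral>\<^sup>+x. ?t x \<partial>lborel)"
    using nn_integral_real_affine[of ?t "-1" 0] by simp
  also have "ennreal (C\<^sup>2) * ((\<integral>\<^sup>+x. ?t x \<partial>lborel) + (\<integral>\<^sup>+x. ?t x \<partial>lborel))
     = ennreal (2 * C\<^sup>2 / (2 * p - 1) * (1 + T) powr (1 - 2 * p))"
    unfolding nn_integral_powr_tail[OF p T]
    using p by (simp add: ennreal_plus[symmetric] ennreal_mult[symmetric] del: ennreal_plus)
  finally show "(\<integral>\<^sup>+x. ennreal (indicator (- {- T..T}) x * (cmod (f x))\<^sup>2) \<partial>lebesgue)
     \<le> ennreal (2 * C\<^sup>2 / (2 * p - 1) * (1 + T) powr (1 - 2 * p))" .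
qed

text \<open>Since \<open>ln 9\<close> is at least 1, \<open>x\<close> lies below the tangent line of
  \<open>9 powr (x - 1)\<close> at 1, and convexity does the rest. It converts a quadratic bound
  into the exponential form of the first case.\<close>

lemma mult_9_le_9_powr:
  fixes x :: real
  assumes "1 \<le> x"
  shows "9 * x \<le> 9 powr x"
proof -
  have "exp 1 \<le> (9::real)" using exp_le by simp
  then have "1 \<le> ln (9::real)" by (simp add: ln_ge_iff)
  then have "x \<le> 1 + (x - 1) * ln 9"
    using assms mult_left_mono[of 1 "ln 9" "x - 1"] by simp
  also have "\<dots> \<le> exp ((x - 1) * ln 9)" by (rule exp_ge_add_one_self)
  also have "\<dots> = 9 powr (x - 1)" by (simp add: powr_def)
  finally show ?thesis by (simp add: powr_diff)
qed

text \<open>Only the choice of \<open>y\<close> is left. The loss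
  \<open>5 * (K * y powr (1 - 2 * p))\<close> is made constant, of order \<open>1 / y\<close>, or of
  order \<open>1 / y\<^sup>2\<close>; keeping one or two powers of \<open>y\<close> in the loss is
  what requires \<open>1 < p\<close> or \<open>3/2 < p\<close>. The assumption on \<open>K\<close>
  ensures that each \<open>y\<close> is at least 1.\<close>

lemma concentration_bounds:
  fixes n K p :: real
  assumes p: "1/2 < p" and K: "1 \<le> K"
    and main: "\<And>y. 1 \<le> y \<Longrightarrow> n * (1 - 5 * (K * y powr (1 - 2 * p))) \<le> 4 * (y - 1)\<^sup>2"
  shows "n \<le> 9 powr ((40000 * K) powr (2 / (2 * p - 1)))"
    and "1 < p \<Longrightarrow> n \<le> 16 * (200 * K) powr (1 / (p - 1))"
    and "3/2 < p \<Longrightarrow> n \<le> 4 * (250 * K) powr (2 / (2 * p - 3))"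
proof -
  have sq: "(a powr (1 / q))\<^sup>2 = a powr (2 / q)" for a q :: real
    by (simp add: power2_eq_square powr_add[symmetric])
  have ge1: "1 \<le> a powr (1 / q)" if "1 \<le> a" "0 < q" for a q :: real
    using that by (simp add: ge_one_powr_ge_zero)
  have le: "4 * (y - 1)\<^sup>2 \<le> 4 * y\<^sup>2" if "1 \<le> y" for y :: real
    using that by (intro mult_left_mono power_mono) auto
  show "n \<le> 9 powr ((40000 * K) powr (2 / (2 * p - 1)))"
  proof -
    \<comment> \<open>This makes the loss equal to 1/8000, so \<open>n\<close> is at most 32000/7999
      times \<open>y\<^sup>2\<close>, comfortably below 9 times.\<close>
    define y where "y = (40000 * K) powr (1 / (2 * p - 1))"
    have y: "1 \<le> y" unfolding y_def using p K by (intro ge1) auto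
    have "y powr (1 - 2 * p) = y powr (- (2 * p - 1))" by simp
    also have "\<dots> = 1 / (40000 * K)"
      unfolding powr_minus y_def powr_powr using p K by (simp add: inverse_eq_divide)
    finally have "n * (1 - 5 / 40000) \<le> 4 * (y - 1)\<^sup>2"
      using main[OF y] K by simp
    then have "n * (1 - 5 / 40000) \<le> 4 * y\<^sup>2"
      using le[OF y] by (rule order_trans)
    then have "n * 7999 \<le> 32000 * y\<^sup>2" by simp
    then have "n \<le> 9 * y\<^sup>2"
      using zero_le_power2[of y] by linarith
    also have "\<dots> \<le> 9 powr (y\<^sup>2)"
      by (rule mult_9_le_9_powr) (use y in simp)
    finally show ?thesis unfolding y_def sq .
  qed
  show "n \<le> 16 * (200 * K) powr (1 / (p - 1))" if p1: "1 < p"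
  proof -
    \<comment> \<open>The exponent \<open>2 * (p - 1)\<close> is one less than
      \<open>2 * p - 1\<close>, so the loss is \<open>1 / (40 * y)\<close>, at most 1/40.\<close>
    define y where "y = (200 * K) powr (1 / (2 * (p - 1)))"
    have y: "1 \<le> y" unfolding y_def using p1 K by (intro ge1) auto
    have "y powr (1 - 2 * p) = y powr (- (2 * (p - 1))) * y powr (- 1)"
      unfolding powr_add[symmetric] by simp
    also have "y powr (- (2 * (p - 1))) = 1 / (200 * K)"
      unfolding powr_minus y_def powr_powr using p1 K by (simp add: inverse_eq_divide)
    finally have "5 * (K * y powr (1 - 2 * p)) = 1 / (40 * y)"
      using K y by (simp add: powr_minus inverse_eq_divide)
    also have "\<dots> \<le> 1 / 40" using y by (simp add: divide_simps)
    finally have eps: "1 - 1 / 40 \<le> 1 - 5 * (K * y powr (1 - 2 * p))" by simp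
    have "n \<le> 16 * y\<^sup>2"
    \<comment> \<open>Here \<open>n\<close> is an arbitrary real, and multiplying the estimate of
      the loss by it needs a sign.\<close>
    proof (cases "n \<le> 0")
      case True
      then show ?thesis using zero_le_power2[of y] by linarith
    next
      case False
      then have "n * (1 - 1 / 40) \<le> n * (1 - 5 * (K * y powr (1 - 2 * p)))"
        by (intro mult_left_mono eps) simp
      also have "\<dots> \<le> 4 * (y - 1)\<^sup>2" by (rule main[OF y])
      finally have "n * 39 \<le> 160 * (y - 1)\<^sup>2" by simp
      then show ?thesis using le[OF y] zero_le_power2[of y] by linarith
    qed
    moreover have "2 / (2 * (p - 1)) = 1 / (p - 1)"
      using p1 by (simp add: field_simps)
    ultimately show ?thesis unfolding y_def sq by (simp only:)
  qed
  show "n \<le> 4 * (250 * K) powr (2 / (2 * p - 3))" if p2: "3/2 < p"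
  proof -
    \<comment> \<open>The exponent \<open>2 * p - 3\<close> is two less than
      \<open>2 * p - 1\<close>, so the loss is \<open>1 / (50 * y\<^sup>2)\<close>.\<close>
    define y where "y = (250 * K) powr (1 / (2 * p - 3))"
    have y: "1 \<le> y" unfolding y_def using p2 K by (intro ge1) auto
    have "y powr (1 - 2 * p) = y powr (- (2 * p - 3)) * y powr (- 2)"
      unfolding powr_add[symmetric] by simp
    also have "y powr (- (2 * p - 3)) = 1 / (250 * K)"
      unfolding powr_minus y_def powr_powr using p2 K by (simp add: inverse_eq_divide)
    finally have eps: "5 * (K * y powr (1 - 2 * p)) = 1 / (50 * y\<^sup>2)"
      using K y by (simp add: powr_minus inverse_eq_divide)
    have "n \<le> 4 * y\<^sup>2"
    \<comment> \<open>If \<open>n\<close> exceeded \<open>4 * y\<^sup>2\<close>, the loss would cost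
      only the constant 4/50, whereas \<open>4 * (y - 1)\<^sup>2\<close> falls short of
      \<open>4 * y\<^sup>2\<close> by \<open>8 * y - 4\<close>, which is at least 4.\<close>
    proof (rule ccontr)
      assume "\<not> n \<le> 4 * y\<^sup>2"
      moreover have "0 \<le> 1 - 1 / (50 * y\<^sup>2)"
        using one_le_power[OF y, of 2] by (simp add: divide_simps)
      ultimately have "4 * y\<^sup>2 * (1 - 1 / (50 * y\<^sup>2)) \<le> n * (1 - 1 / (50 * y\<^sup>2))"
        by (intro mult_right_mono) auto
      also have "\<dots> \<le> 4 * (y - 1)\<^sup>2" using main[OF y] unfolding eps .
      also have "4 * y\<^sup>2 * (1 - 1 / (50 * y\<^sup>2)) = 4 * y\<^sup>2 - 4 / 50"
        using y by (simp add: field_simps)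
      finally show False using y by (simp add: power2_eq_square algebra_simps)
    qed
    then show ?thesis unfolding y_def sq .
  qed
qed

theorem proposition3p9:
  fixes p C :: real and N :: nat and e :: "nat \<Rightarrow> real \<Rightarrow> complex"
  assumes p: "p > 1/2"
    and C: "C \<ge> sqrt ((2 * p - 1) / 2)"
    and orthonormal: "L2_orthonormal {1..N} e"
    and decay: "\<And>n. n \<in> {1..N} \<Longrightarrow>
      AE x in lebesgue. cmod (e n x) \<le> C / (1 + \<bar>x\<bar>) powr p"
    and fourier_decay: "\<And>n. n \<in> {1..N} \<Longrightarrow>
      AE \<xi> in lebesgue. cmod (fourier_L2 (e n) \<xi>) \<le> C / (1 + \<bar>\<xi>\<bar>) powr p"
  shows "(1/2 < p \<longrightarrow>
            real N \<le> 9 powr ((200 * sqrt 2 * C / sqrt (2 * p - 1)) powr (4 / (2 * p - 1)))) \<and>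
         (1 < p \<and> p \<le> 3/2 \<longrightarrow>
            real N \<le> 16 * (400 * C\<^sup>2 / (2 * p - 1)) powr (1 / (p - 1))) \<and>
         (3/2 < p \<longrightarrow>
            real N \<le> 4 * (500 * C\<^sup>2 / (2 * p - 1)) powr (2 / (2 * p - 3)))"
proof -
  define K where "K = 2 * C\<^sup>2 / (2 * p - 1)"
  have C0: "0 < C" using C p by (intro less_le_trans[OF _ C]) simp
  \<comment> \<open>The lower bound on \<open>C\<close> is exactly the condition
    \<open>1 \<le> K\<close>.\<close>
  have "(sqrt ((2 * p - 1) / 2))\<^sup>2 \<le> C\<^sup>2"
    using C p by (intro power_mono) simp_all
  then have K: "1 \<le> K" using p by (simp add: K_def field_simps)
  \<comment> \<open>The denominator is at least 1, so decay includes the essential bound that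
    Plancherel requires.\<close>
  have bounded: "AE x in lebesgue. cmod (e n x) \<le> C" if "n \<in> {1..N}" for n
    using decay[OF that]
  proof eventually_elim
    fix x assume "cmod (e n x) \<le> C / (1 + \<bar>x\<bar>) powr p"
    also have "\<dots> \<le> C / 1"
      using p C0 by (intro divide_left_mono ge_one_powr_ge_zero) auto
    finally show "cmod (e n x) \<le> C" by simp
  qed
  have L2: "e n \<in> L2" if "n \<in> {1..N}" for n
    using orthonormal that by (simp add: L2_orthonormal_def)
  \<comment> \<open>Both intervals have half-length \<open>y - 1\<close>, so the factor
    \<open>1 + T\<close> of the tail estimate becomes \<open>y\<close>.\<close>
  have main: "real N * (1 - 5 * (K * y powr (1 - 2 * p))) \<le> 4 * (y - 1)\<^sup>2" if "1 \<le> y" for y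
  proof -
    have tail: "(LINT x|lebesgue. indicator (- {- (y - 1)..y - 1}) x * (cmod (f x))\<^sup>2) \<le> K * y powr (1 - 2 * p)"
      if "AE x in lebesgue. cmod (f x) \<le> C / (1 + \<bar>x\<bar>) powr p" for f
      using integral_tail_le[OF p _ that, of "y - 1"] \<open>1 \<le> y\<close> by (simp add: K_def)
    have "real (card {1..N}) * (1 - 5 * (K * y powr (1 - 2 * p))) \<le> 4 * (y - 1) * (y - 1)"
      using \<open>1 \<le> y\<close>
      by (intro card_orthonormal_concentrated_le[OF _ orthonormal bounded has_fourier_L2_fourier_L2]
          tail decay fourier_decay L2) simp_all
    then show ?thesis
      unfolding power2_eq_square mult.assoc[symmetric] by (simp only: card_atLeastAtMost diff_Suc_1)
  qed
  \<comment> \<open>The square of the base is \<open>40000 * K\<close>, so squaring it halves the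
    exponent.\<close>
  have base1: "(200 * sqrt 2 * C / sqrt (2 * p - 1)) powr (4 / (2 * p - 1)) = (40000 * K) powr (2 / (2 * p - 1))"
  proof -
    let ?b = "200 * sqrt 2 * C / sqrt (2 * p - 1)"
    have "?b powr (4 / (2 * p - 1)) = (?b powr 2) powr (2 / (2 * p - 1))"
      unfolding powr_powr by simp
    also have "?b powr 2 = ?b\<^sup>2"
      using C0 p by (intro powr_numeral) (auto intro!: divide_pos_pos mult_pos_pos)
    also have "\<dots> = 40000 * K"
      using p by (simp add: K_def power_mult_distrib power_divide)
    finally show ?thesis .
  qed
  have base23: "400 * C\<^sup>2 / (2 * p - 1) = 200 * K" "500 * C\<^sup>2 / (2 * p - 1) = 250 * K"
    by (simp_all add: K_def)
  note bounds = concentration_bounds[OF p K main]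
  show ?thesis
    unfolding base1 base23
    using bounds(1) bounds(2) bounds(3) by (intro conjI impI) (simp_all only:)
qed

end
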